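(* Let $L=\mathscr{W}_L(\Gamma)$ be the generalized loop Virasoro algebra, with Lie bracket $\phi$. Every Lie bialgebra structure on $L$ is coboundary triangular. That is, for every linear map $\Delta: L\to L\otimes L$ such that $(L,\phi,\Delta)$ is a Lie bialgebra, there exists $r\in \mathrm{Im}(1\otimes 1-\tau)\subset L\otimes L$ such that $\Delta(x)=x\cdot r$ for all $x\in L$ and $c(r)=0$.
   Context: $\mathbb{F}$ is a field of characteristic zero; all tensor products are over $\mathbb{F}$. $\Gamma$ is an additive subgroup of $\mathbb{F}$ with $1\in\Gamma$. The group algebra $\mathbb{F}[\Gamma]$ has basis $\{e^\alpha\mid\alpha\in\Gamma\}$, and $\partial$ is the operator $\partial(e^\alpha)=\alpha e^\alpha$; $\mathscr{W}(\Gamma)=\mathbb{F}[\Gamma]\partial$ is the generalized Witt (centerless Virasoro) algebra. The generalized loop Virasoro algebra is $\mathscr{W}_L(\Gamma)=\mathscr{W}(\Gamma)\otimes\mathbb{F}[t^{\pm1}]$; it has basis $L_{\alpha,i}=e^\alpha\partial\otimes t^i$ ($\alpha\in\Gamma$, $i\in\mathbb{Z}$) and bracket $[L_{\alpha,i},L_{\beta,j}]=(\beta-\alpha)L_{\alpha+\beta,i+j}$. For a vector space $L$, $\tau:L\otimes L\to L\otimes L$ is the twist $\tau(x\otimes y)=y\otimes x$, and $\varepsilon:L^{\otimes 3}\to L^{\otimes 3}$ is $\varepsilon(x_1\otimes x_2\otimes x_3)=x_2\otimes x_3\otimes x_1$; $1$ denotes the identity map. A Lie coalgebra is a pair $(L,\Delta)$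 with $\Delta:L\to L\otimes L$ linear, $\mathrm{Im}\,\Delta\subset\mathrm{Im}(1\otimes 1-\tau)$ and $(1\otimes1\otimes1+\varepsilon+\varepsilon^2)(1\otimes\Delta)\Delta=0$. A Lie bialgebra is a triple $(L,\phi,\Delta)$ where $(L,\phi)$ is a Lie algebra with bracket $\phi:L\otimes L\to L$, $(L,\Delta)$ is a Lie coalgebra, and $\Delta\phi(x\otimes y)=x\cdot\Delta y-y\cdot\Delta x$ for all $x,y\in L$, where $\cdot$ is the adjoint diagonal action $x\cdot(a\otimes b)=[x,a]\otimes b+a\otimes[x,b]$. A coboundary Lie bialgebra is $(L,\phi,\Delta,r)$ where $(L,\phi,\Delta)$ is a Lie bialgebra, $r\in\mathrm{Im}(1\otimes1-\tau)$, and $\Delta(x)=x\cdot r$ for all $x\in L$. It is triangular if $c(r)=0$ (Classical Yang-Baxter Equation), where for $r=\sum_i a_i\otimes b_i$, in $U(L)^{\otimes3}$ ($U(L)$ the universal enveloping algebra of $L$, with identity element $1$), $r^{12}=\sum_i a_i\otimes b_i\otimes1$, $r^{13}=\sum_i a_i\otimes1\otimes b_i$, $r^{23}=\sum_i1\otimes a_i\otimes b_i$, and $c(r)=[r^{12},r^{13}]+[r^{12},r^{23}]+[r^{13},r^{23}]$. *)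

theory Defs
  imports Complex_Main "HOL-Library.Poly_Mapping" "HOL-Library.Product_Plus"
begin

text \<open>
  A vector space over a field \<open>'a\<close> with basis \<open>B :: 'b set\<close> is modelled as \<open>free_space B\<close>, the
  finitely supported functions \<open>'b \<Rightarrow>\<^sub>0 'a\<close> with support in \<open>B\<close>; the basis vector belonging to
  \<open>b\<close> is \<open>Poly_Mapping.single b 1\<close>.  The tensor product of the spaces with bases \<open>B\<close> and \<open>C\<close> is
  the space with basis \<open>B \<times> C\<close>; its universal property is \<open>tensor_universal\<close> below.
\<close>

definition scale_pm :: "'a::field \<Rightarrow> ('b \<Rightarrow>\<^sub>0 'a) \<Rightarrow> ('b \<Rightarrow>\<^sub>0 'a)" (infixr "*\<^sub>p" 75)
  where "c *\<^sub>p f = Poly_Mapping.map ((*) c) f"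

definition free_space :: "'b set \<Rightarrow> ('b \<Rightarrow>\<^sub>0 'a::field) set"
  where "free_space B = {f. Poly_Mapping.keys f \<subseteq> B}"

definition linear_on :: "('b \<Rightarrow>\<^sub>0 'a::field) set \<Rightarrow> ('c \<Rightarrow>\<^sub>0 'a) set \<Rightarrow> (('b \<Rightarrow>\<^sub>0 'a) \<Rightarrow> ('c \<Rightarrow>\<^sub>0 'a)) \<Rightarrow> bool"
  where "linear_on V W h \<longleftrightarrow> h ` V \<subseteq> W \<and>
    (\<forall>x\<in>V. \<forall>y\<in>V. h (x + y) = h x + h y) \<and> (\<forall>c. \<forall>x\<in>V. h (c *\<^sub>p x) = c *\<^sub>p h x)"

definition lin_ext :: "('b \<Rightarrow> ('c \<Rightarrow>\<^sub>0 'a::field)) \<Rightarrow> ('b \<Rightarrow>\<^sub>0 'a) \<Rightarrow> ('c \<Rightarrow>\<^sub>0 'a)"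
  where "lin_ext \<phi> f = (\<Sum>b\<in>Poly_Mapping.keys f. Poly_Mapping.lookup f b *\<^sub>p \<phi> b)"

definition tensor :: "('b \<Rightarrow>\<^sub>0 'a::field) \<Rightarrow> ('c \<Rightarrow>\<^sub>0 'a) \<Rightarrow> ('b \<times> 'c \<Rightarrow>\<^sub>0 'a)"  (infixr "\<otimes>\<^sub>F" 76)
  where "f \<otimes>\<^sub>F g = lin_ext (\<lambda>b. lin_ext (\<lambda>c. Poly_Mapping.single (b, c) 1) g) f"

lemma lookup_scale_pm [simp]: "Poly_Mapping.lookup (c *\<^sub>p f) b = c * Poly_Mapping.lookup f b"
  by (simp add: scale_pm_def map.rep_eq when_def)

interpretation pm: vector_space "scale_pm :: 'a::field \<Rightarrow> ('b \<Rightarrow>\<^sub>0 'a) \<Rightarrow> ('b \<Rightarrow>\<^sub>0 'a)"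
  by unfold_locales (auto intro!: poly_mapping_eqI simp: lookup_add algebra_simps)

lemma scale_single [simp]: "c *\<^sub>p Poly_Mapping.single b d = Poly_Mapping.single b (c * d)"
  by (rule poly_mapping_eqI) (simp add: lookup_single when_def)

lemma lin_ext_superset:
  assumes "finite S" "Poly_Mapping.keys f \<subseteq> S"
  shows "lin_ext \<phi> f = (\<Sum>b\<in>S. Poly_Mapping.lookup f b *\<^sub>p \<phi> b)"
  unfolding lin_ext_def
  by (rule sum.mono_neutral_left) (use assms in \<open>auto simp: in_keys_iff\<close>)

lemma lin_ext_add [simp]: "lin_ext \<phi> (f + g) = lin_ext \<phi> f + lin_ext \<phi> g"
proof -
  let ?S = "Poly_Mapping.keys f \<union> Poly_Mapping.keys g"
  have S: "finite ?S" "Poly_Mapping.keys (f + g) \<subseteq> ?S" by (simp_all add: keys_add)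
  show ?thesis
    using lin_ext_superset[OF S, of \<phi>] lin_ext_superset[of ?S f \<phi>] lin_ext_superset[of ?S g \<phi>]
    by (simp add: lookup_add pm.scale_left_distrib sum.distrib)
qed

lemma lin_ext_scale [simp]: "lin_ext \<phi> (c *\<^sub>p f) = c *\<^sub>p lin_ext \<phi> f"
proof -
  have "Poly_Mapping.keys (c *\<^sub>p f) \<subseteq> Poly_Mapping.keys f" by (auto simp: in_keys_iff)
  from lin_ext_superset[OF _ this, of \<phi>] show ?thesis
    by (simp add: lin_ext_def[of \<phi> f] pm.scale_sum_right)
qed

lemma lin_ext_zero [simp]: "lin_ext \<phi> 0 = 0"
  by (simp add: lin_ext_def)

lemma lin_ext_sum [simp]: "lin_ext \<phi> (\<Sum>i\<in>I. f i) = (\<Sum>i\<in>I. lin_ext \<phi> (f i))"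
  by (induction I rule: infinite_finite_induct) auto

lemma lin_ext_single [simp]: "lin_ext \<phi> (Poly_Mapping.single b c) = c *\<^sub>p \<phi> b"
  by (simp add: lin_ext_def)

lemma lin_ext_basis: "lin_ext (\<lambda>b. Poly_Mapping.single b 1) f = f"
  by (rule poly_mapping_eqI)
     (simp add: lin_ext_def lookup_sum lookup_single when_def if_distrib sum.delta in_keys_iff cong: if_cong)

lemma single_add_induct [case_names single add]:
  fixes f :: "'b \<Rightarrow>\<^sub>0 'a::field"
  assumes "\<And>b c. P (Poly_Mapping.single b c)" "\<And>f g. P f \<Longrightarrow> P g \<Longrightarrow> P (f + g)"
  shows "P f"
proof -
  have "P 0" using assms(1)[of undefined 0] by simp
  have "P (\<Sum>b\<in>S. Poly_Mapping.lookup f b *\<^sub>p Poly_Mapping.single b 1)" if "finite S" for S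
    using that by (induction S rule: finite_induct) (auto simp: \<open>P 0\<close> intro!: assms)
  from this[of "Poly_Mapping.keys f"] show ?thesis
    by (simp add: lin_ext_def[symmetric] lin_ext_basis del: scale_single)
qed

lemma linear_expand:
  assumes "\<And>x y. h (x + y) = h x + h y" "\<And>c x. h (c *\<^sub>p x) = c *\<^sub>p h x"
  shows "h f = lin_ext (\<lambda>b. h (Poly_Mapping.single b 1)) f"
proof -
  have "h 0 = 0" using assms(2)[of 0 0] by simp
  then have sum: "h (\<Sum>i\<in>I. u i) = (\<Sum>i\<in>I. h (u i))" for u :: "'i \<Rightarrow> _" and I
    by (induction I rule: infinite_finite_induct) (auto simp: assms(1))
  have "h f = h (\<Sum>b\<in>Poly_Mapping.keys f. Poly_Mapping.lookup f b *\<^sub>p Poly_Mapping.single b 1)"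
    using lin_ext_basis[of f] by (simp only: lin_ext_def)
  then show ?thesis
    unfolding lin_ext_def by (simp only: sum assms(2))
qed

lemma tensor_add_left: "(f + f') \<otimes>\<^sub>F g = f \<otimes>\<^sub>F g + f' \<otimes>\<^sub>F g"
  and tensor_scale_left: "(c *\<^sub>p f) \<otimes>\<^sub>F g = c *\<^sub>p (f \<otimes>\<^sub>F g)"
  and tensor_add_right: "f \<otimes>\<^sub>F (g + g') = f \<otimes>\<^sub>F g + f \<otimes>\<^sub>F g'"
  and tensor_scale_right: "f \<otimes>\<^sub>F (c *\<^sub>p g) = c *\<^sub>p (f \<otimes>\<^sub>F g)"
  by (simp_all add: tensor_def)
     (simp_all add: lin_ext_def[of _ f] pm.scale_right_distrib sum.distrib pm.scale_sum_right mult.commute)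

lemma tensor_single [simp]:
  "Poly_Mapping.single b 1 \<otimes>\<^sub>F Poly_Mapping.single c 1 = Poly_Mapping.single (b, c) 1"
  by (simp add: tensor_def)

lemma tensor_universal:
  fixes h :: "('b \<Rightarrow>\<^sub>0 'a::field) \<Rightarrow> ('c \<Rightarrow>\<^sub>0 'a) \<Rightarrow> ('d \<Rightarrow>\<^sub>0 'a)"
  assumes "\<And>x y z. h (x + y) z = h x z + h y z" "\<And>c x z. h (c *\<^sub>p x) z = c *\<^sub>p h x z"
    and "\<And>x y z. h x (y + z) = h x y + h x z" "\<And>c x y. h x (c *\<^sub>p y) = c *\<^sub>p h x y"
  shows "h f g = lin_ext (\<lambda>(b, c). h (Poly_Mapping.single b 1) (Poly_Mapping.single c 1)) (f \<otimes>\<^sub>F g)"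
proof -
  have "h f g = lin_ext (\<lambda>b. h (Poly_Mapping.single b 1) g) f"
    by (rule linear_expand) (rule assms)+
  also have "\<dots> = lin_ext (\<lambda>b. lin_ext (\<lambda>c. h (Poly_Mapping.single b 1) (Poly_Mapping.single c 1)) g) f"
    by (subst linear_expand[of "h (Poly_Mapping.single _ 1)"]) (simp_all only: assms)
  also have "\<dots> = lin_ext (\<lambda>(b, c). h (Poly_Mapping.single b 1) (Poly_Mapping.single c 1)) (f \<otimes>\<^sub>F g)"
    by (simp add: tensor_def lin_ext_def[of _ f] lin_ext_def[of _ g])
  finally show ?thesis .
qed

definition twist :: "('b \<times> 'b \<Rightarrow>\<^sub>0 'a::field) \<Rightarrow> ('b \<times> 'b \<Rightarrow>\<^sub>0 'a)"
  where "twist = lin_ext (\<lambda>(a, b). Poly_Mapping.single (b, a) 1)"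

definition cycle3 :: "('b \<times> 'b \<times> 'b \<Rightarrow>\<^sub>0 'a::field) \<Rightarrow> ('b \<times> 'b \<times> 'b \<Rightarrow>\<^sub>0 'a)"
  where "cycle3 = lin_ext (\<lambda>(a, b, c). Poly_Mapping.single (b, c, a) 1)"

definition id_tensor :: "(('b \<Rightarrow>\<^sub>0 'a::field) \<Rightarrow> ('b \<times> 'b \<Rightarrow>\<^sub>0 'a)) \<Rightarrow> ('b \<times> 'b \<Rightarrow>\<^sub>0 'a) \<Rightarrow> ('b \<times> 'b \<times> 'b \<Rightarrow>\<^sub>0 'a)"
  where "id_tensor \<Delta> = lin_ext (\<lambda>(a, b). Poly_Mapping.single a 1 \<otimes>\<^sub>F \<Delta> (Poly_Mapping.single b 1))"

definition skew_tensors :: "'b set \<Rightarrow> ('b \<times> 'b \<Rightarrow>\<^sub>0 'a::field) set"  \<comment> \<open>\<open>Im (1 \<otimes> 1 - \<tau>)\<close>\<close>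
  where "skew_tensors B = (\<lambda>v. v - twist v) ` free_space (B \<times> B)"

lemma twist_tensor: "twist (f \<otimes>\<^sub>F g) = g \<otimes>\<^sub>F f"
  using tensor_universal[of "\<lambda>f g. g \<otimes>\<^sub>F f" f g]
  by (simp add: twist_def tensor_add_left tensor_add_right tensor_scale_left tensor_scale_right)

type_synonym ('b, 'a) bracket = "('b \<Rightarrow>\<^sub>0 'a) \<Rightarrow> ('b \<Rightarrow>\<^sub>0 'a) \<Rightarrow> ('b \<Rightarrow>\<^sub>0 'a)"

definition lie_algebra :: "'b set \<Rightarrow> ('b, 'a::field) bracket \<Rightarrow> bool"
  where "lie_algebra B br \<longleftrightarrow>
    (\<forall>x\<in>free_space B. linear_on (free_space B) (free_space B) (br x)) \<and>
    (\<forall>y\<in>free_space B. linear_on (free_space B) (free_space B) (\<lambda>x. br x y)) \<and>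
    (\<forall>x\<in>free_space B. br x x = 0) \<and>
    (\<forall>x\<in>free_space B. \<forall>y\<in>free_space B. \<forall>z\<in>free_space B.
       br x (br y z) + br y (br z x) + br z (br x y) = 0)"

definition lie_coalgebra :: "'b set \<Rightarrow> (('b \<Rightarrow>\<^sub>0 'a::field) \<Rightarrow> ('b \<times> 'b \<Rightarrow>\<^sub>0 'a)) \<Rightarrow> bool"
  where "lie_coalgebra B \<Delta> \<longleftrightarrow>
    linear_on (free_space B) (free_space (B \<times> B)) \<Delta> \<and>
    \<Delta> ` free_space B \<subseteq> skew_tensors B \<and>
    (\<forall>x\<in>free_space B. let w = id_tensor \<Delta> (\<Delta> x) in w + cycle3 w + cycle3 (cycle3 w) = 0)"

definition diag_action :: "('b, 'a::field) bracket \<Rightarrow> ('b \<Rightarrow>\<^sub>0 'a) \<Rightarrow> ('b \<times> 'b \<Rightarrow>\<^sub>0 'a) \<Rightarrow> ('b \<times> 'b \<Rightarrow>\<^sub>0 'a)"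
  where "diag_action br x = lin_ext (\<lambda>(a, b).
    br x (Poly_Mapping.single a 1) \<otimes>\<^sub>F Poly_Mapping.single b 1 +
    Poly_Mapping.single a 1 \<otimes>\<^sub>F br x (Poly_Mapping.single b 1))"

definition lie_bialgebra ::
    "'b set \<Rightarrow> ('b, 'a::field) bracket \<Rightarrow> (('b \<Rightarrow>\<^sub>0 'a) \<Rightarrow> ('b \<times> 'b \<Rightarrow>\<^sub>0 'a)) \<Rightarrow> bool"
  where "lie_bialgebra B br \<Delta> \<longleftrightarrow> lie_algebra B br \<and> lie_coalgebra B \<Delta> \<and>
    (\<forall>x\<in>free_space B. \<forall>y\<in>free_space B.
       \<Delta> (br x y) = diag_action br x (\<Delta> y) - diag_action br y (\<Delta> x))"

text \<open>
  Words over \<open>B\<close> form the free monoid, written additively.  With the convolution product of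
  finitely supported functions, \<open>free_space (lists B)\<close> is the tensor algebra \<open>T(L)\<close> of
  \<open>L = free_space B\<close>, and \<open>free_space (lists B \<times> lists B \<times> lists B)\<close> is \<open>T(L) \<otimes> T(L) \<otimes> T(L)\<close> with
  its componentwise product.
\<close>

instantiation list :: (type) monoid_add
begin
definition zero_list :: "'a list" where "zero_list = []"
definition plus_list :: "'a list \<Rightarrow> 'a list \<Rightarrow> 'a list" where "plus_list = (@)"
instance by standard (simp_all add: zero_list_def plus_list_def)
end

lemma tensor_mult:
  fixes f f' :: "'b::monoid_add \<Rightarrow>\<^sub>0 'a::field" and g g' :: "'c::monoid_add \<Rightarrow>\<^sub>0 'a"
  shows "(f \<otimes>\<^sub>F g) * (f' \<otimes>\<^sub>F g') = (f * f') \<otimes>\<^sub>F (g * g')"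
proof -
  have scl: "(c *\<^sub>p p) * q = c *\<^sub>p (p * q)" "p * (c *\<^sub>p q) = c *\<^sub>p (p * q)"
    for c and p q :: "'d::monoid_add \<Rightarrow>\<^sub>0 'a"
  proof -
    have c: "c *\<^sub>p u = Poly_Mapping.single 0 c * u" for u :: "'d \<Rightarrow>\<^sub>0 'a"
      by (simp add: scale_pm_def mult_map_scale_conv_mult)
    have comm: "Poly_Mapping.single 0 c * u = u * Poly_Mapping.single 0 c" for u :: "'d \<Rightarrow>\<^sub>0 'a"
    proof -
      have "Poly_Mapping.single 0 c * Poly_Mapping.single b 1 = Poly_Mapping.single b 1 * Poly_Mapping.single 0 c" for b :: 'd
        by (simp add: mult_single)
      then show ?thesis
        by (induction u rule: single_add_induct) (simp_all add: mult_single mult.commute algebra_simps)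
    qed
    show "(c *\<^sub>p p) * q = c *\<^sub>p (p * q)" by (simp add: c mult.assoc)
    show "p * (c *\<^sub>p q) = c *\<^sub>p (p * q)"
      by (simp only: c mult.assoc[symmetric] comm[of p])
  qed
  have zero: "0 \<otimes>\<^sub>F u = 0" "w \<otimes>\<^sub>F 0 = 0" for u :: "'d \<Rightarrow>\<^sub>0 'a" and w :: "'e \<Rightarrow>\<^sub>0 'a"
    using tensor_scale_left[of 0 0 u] tensor_scale_right[of w 0 0] by simp_all
  have sng: "Poly_Mapping.single b x \<otimes>\<^sub>F Poly_Mapping.single c y = Poly_Mapping.single (b, c) (x * y)"
    for b :: 'd and c :: 'e and x y :: 'a
    by (simp add: tensor_def)
  show ?thesis
  proof (induction f rule: single_add_induct)
    case (single b x)
    show ?case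
    proof (induction g rule: single_add_induct)
      case (single c y)
      show ?case
      proof (induction f' rule: single_add_induct)
        case (single b' x')
        show ?case
          by (induction g' rule: single_add_induct)
             (simp_all add: sng mult_single ac_simps tensor_add_right distrib_left)
      qed (simp add: tensor_add_left tensor_add_right distrib_left)
    qed (simp add: tensor_add_left tensor_add_right distrib_left distrib_right)
  qed (simp add: tensor_add_left tensor_add_right distrib_left distrib_right)
qed

definition letter :: "('b \<Rightarrow>\<^sub>0 'a::field) \<Rightarrow> ('b list \<Rightarrow>\<^sub>0 'a)"
  where "letter = lin_ext (\<lambda>b. Poly_Mapping.single [b] 1)"

definition commutator :: "'r::ring \<Rightarrow> 'r \<Rightarrow> 'r"
  where "commutator p q = p * q - q * p"

text \<open>
  \<open>U(L) = T(L) / J\<close> where \<open>J = env_ideal B br\<close>, and \<open>U(L) \<otimes> U(L) \<otimes> U(L)\<close> is the quotient of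
  \<open>T(L) \<otimes> T(L) \<otimes> T(L)\<close> by \<open>env3_ideal B br = J \<otimes> T \<otimes> T + T \<otimes> J \<otimes> T + T \<otimes> T \<otimes> J\<close>, the kernel of the
  threefold tensor power of the projection \<open>T(L) \<rightarrow> U(L)\<close>.
\<close>

definition env_ideal :: "'b set \<Rightarrow> ('b, 'a::field) bracket \<Rightarrow> ('b list \<Rightarrow>\<^sub>0 'a) set"
  where "env_ideal B br = pm.span
    {u * (commutator (letter x) (letter y) - letter (br x y)) * v | u v x y.
       u \<in> free_space (lists B) \<and> v \<in> free_space (lists B) \<and> x \<in> free_space B \<and> y \<in> free_space B}"

definition env3_ideal :: "'b set \<Rightarrow> ('b, 'a::field) bracket \<Rightarrow> ('b list \<times> 'b list \<times> 'b list \<Rightarrow>\<^sub>0 'a) set"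
  where "env3_ideal B br = pm.span (\<Union>j\<in>env_ideal B br. \<Union>u\<in>free_space (lists B). \<Union>v\<in>free_space (lists B).
    {j \<otimes>\<^sub>F u \<otimes>\<^sub>F v, u \<otimes>\<^sub>F j \<otimes>\<^sub>F v, u \<otimes>\<^sub>F v \<otimes>\<^sub>F j})"

definition r12 :: "('b \<times> 'b \<Rightarrow>\<^sub>0 'a::field) \<Rightarrow> ('b list \<times> 'b list \<times> 'b list \<Rightarrow>\<^sub>0 'a)"
  where "r12 = lin_ext (\<lambda>(a, b). letter (Poly_Mapping.single a 1) \<otimes>\<^sub>F letter (Poly_Mapping.single b 1) \<otimes>\<^sub>F 1)"

definition r13 :: "('b \<times> 'b \<Rightarrow>\<^sub>0 'a::field) \<Rightarrow> ('b list \<times> 'b list \<times> 'b list \<Rightarrow>\<^sub>0 'a)"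
  where "r13 = lin_ext (\<lambda>(a, b). letter (Poly_Mapping.single a 1) \<otimes>\<^sub>F 1 \<otimes>\<^sub>F letter (Poly_Mapping.single b 1))"

definition r23 :: "('b \<times> 'b \<Rightarrow>\<^sub>0 'a::field) \<Rightarrow> ('b list \<times> 'b list \<times> 'b list \<Rightarrow>\<^sub>0 'a)"
  where "r23 = lin_ext (\<lambda>(a, b). 1 \<otimes>\<^sub>F letter (Poly_Mapping.single a 1) \<otimes>\<^sub>F letter (Poly_Mapping.single b 1))"

text \<open>
  \<open>cyb r\<close> is the representative of \<open>c(r)\<close> in \<open>T(L) \<otimes> T(L) \<otimes> T(L)\<close>; hence \<open>c(r) = 0\<close> in
  \<open>U(L) \<otimes> U(L) \<otimes> U(L)\<close> means that \<open>cyb r\<close> lies in \<open>env3_ideal\<close>.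
\<close>

definition cyb :: "('b \<times> 'b \<Rightarrow>\<^sub>0 'a::field) \<Rightarrow> ('b list \<times> 'b list \<times> 'b list \<Rightarrow>\<^sub>0 'a)"
  where "cyb r = commutator (r12 r) (r13 r) + commutator (r12 r) (r23 r) + commutator (r13 r) (r23 r)"

definition classical_yang_baxter :: "'b set \<Rightarrow> ('b, 'a::field) bracket \<Rightarrow> ('b \<times> 'b \<Rightarrow>\<^sub>0 'a) \<Rightarrow> bool"
  where "classical_yang_baxter B br r \<longleftrightarrow> cyb r \<in> env3_ideal B br"

definition additive_subgroup_of_field :: "'a::field set \<Rightarrow> bool"
  where "additive_subgroup_of_field \<Gamma> \<longleftrightarrow> 0 \<in> \<Gamma> \<and> (\<forall>x\<in>\<Gamma>. \<forall>y\<in>\<Gamma>. x + y \<in> \<Gamma>) \<and> (\<forall>x\<in>\<Gamma>. - x \<in> \<Gamma>)"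

text \<open>
  With the convolution product, \<open>free_space (\<Gamma> \<times> UNIV)\<close> is the commutative algebra
  \<open>F[\<Gamma>] \<otimes> F[t, 1/t]\<close>; the basis vector of \<open>(\<alpha>, i)\<close> is \<open>e^\<alpha> \<otimes> t^i\<close>.  The loop algebra
  \<open>W(\<Gamma>) \<otimes> F[t, 1/t]\<close> is identified with this space by letting \<open>f\<close> stand for the vector field
  \<open>f \<partial>\<close>, where \<open>\<partial>\<close> is extended by \<open>\<partial>(t) = 0\<close>, so that \<open>[f \<partial>, g \<partial>] = (f \<partial>(g) - g \<partial>(f)) \<partial>\<close>.
\<close>

definition loop_derivation :: "('a \<times> int \<Rightarrow>\<^sub>0 'a::field) \<Rightarrow> ('a \<times> int \<Rightarrow>\<^sub>0 'a)"
  where "loop_derivation = lin_ext (\<lambda>(\<alpha>, i). Poly_Mapping.single (\<alpha>, i) \<alpha>)"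

definition loop_virasoro_basis :: "'a::field set \<Rightarrow> ('a \<times> int) set"
  where "loop_virasoro_basis \<Gamma> = \<Gamma> \<times> UNIV"

definition loop_virasoro_bracket :: "('a \<times> int, 'a::field) bracket"
  where "loop_virasoro_bracket f g = f * loop_derivation g - g * loop_derivation f"

lemma loop_virasoro_bracket_basis:
  fixes \<alpha> \<beta> :: "'a::field"
  shows "loop_virasoro_bracket (Poly_Mapping.single (\<alpha>, i) 1) (Poly_Mapping.single (\<beta>, j) 1)
    = (\<beta> - \<alpha>) *\<^sub>p Poly_Mapping.single (\<alpha> + \<beta>, i + j) 1"
  by (simp add: loop_virasoro_bracket_def loop_derivation_def mult_single single_diff
      add.commute[of \<beta>] add.commute[of j])

lemma loop_virasoro_lie_algebra:
  fixes \<Gamma> :: "'a::field set"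
  assumes "additive_subgroup_of_field \<Gamma>"
  shows "lie_algebra (loop_virasoro_basis \<Gamma>) loop_virasoro_bracket"
proof -
  let ?L = "free_space (loop_virasoro_basis \<Gamma>) :: ('a \<times> int \<Rightarrow>\<^sub>0 'a) set"
  note D = loop_derivation_def
  have c: "c *\<^sub>p u = Poly_Mapping.single 0 c * u" for c and u :: "'a \<times> int \<Rightarrow>\<^sub>0 'a"
    by (simp add: scale_pm_def mult_map_scale_conv_mult)
  have D_add: "loop_derivation (f + g) = loop_derivation f + loop_derivation g" for f g :: "'a \<times> int \<Rightarrow>\<^sub>0 'a"
    by (simp add: D)
  have D_diff: "loop_derivation (f - g) = loop_derivation f - loop_derivation g" for f g :: "'a \<times> int \<Rightarrow>\<^sub>0 'a"
    using D_add[of "f - g" g] by (simp add: algebra_simps)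
  have D_scale: "loop_derivation (c *\<^sub>p g) = c *\<^sub>p loop_derivation g" for c and g :: "'a \<times> int \<Rightarrow>\<^sub>0 'a"
    by (simp add: D)
  have D_single: "loop_derivation (Poly_Mapping.single k x) = Poly_Mapping.single k (x * fst k)"
    for k :: "'a \<times> int" and x
    by (simp add: D split_beta)
  have leibniz: "loop_derivation (f * g) = loop_derivation f * g + f * loop_derivation g" for f g :: "'a \<times> int \<Rightarrow>\<^sub>0 'a"
  proof (induction f rule: single_add_induct)
    case (single b x)
    show ?case
      by (induction g rule: single_add_induct)
         (simp_all add: D_single D_add mult_single single_add[symmetric] algebra_simps)
  qed (simp add: D_add algebra_simps)
  have D_keys: "Poly_Mapping.keys (loop_derivation f) \<subseteq> Poly_Mapping.keys f" for f :: "'a \<times> int \<Rightarrow>\<^sub>0 'a"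
  proof
    fix k assume k: "k \<in> Poly_Mapping.keys (loop_derivation f)"
    show "k \<in> Poly_Mapping.keys f"
    proof (rule ccontr)
      assume "k \<notin> Poly_Mapping.keys f"
      then have "Poly_Mapping.lookup (loop_derivation f) k = 0"
        by (auto simp: D lin_ext_def lookup_sum split_beta lookup_single when_def intro!: sum.neutral)
      with k show False by (simp add: in_keys_iff)
    qed
  qed
  have mult: "f * g \<in> ?L" if "f \<in> ?L" "g \<in> ?L" for f g
  proof -
    have "a + b \<in> loop_virasoro_basis \<Gamma>" if "a \<in> loop_virasoro_basis \<Gamma>" "b \<in> loop_virasoro_basis \<Gamma>" for a b
      using that assms by (auto simp: loop_virasoro_basis_def additive_subgroup_of_field_def)
    then show ?thesis
      using keys_mult[of f g] that unfolding free_space_def by blast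
  qed
  have "loop_virasoro_bracket f g \<in> ?L" if "f \<in> ?L" "g \<in> ?L" for f g
  proof -
    have "loop_derivation f \<in> ?L" "loop_derivation g \<in> ?L"
      using D_keys that by (auto simp: free_space_def)
    with mult that have "f * loop_derivation g \<in> ?L" "g * loop_derivation f \<in> ?L" by auto
    then show ?thesis
      using keys_diff[of "f * loop_derivation g" "g * loop_derivation f"]
      by (auto simp: loop_virasoro_bracket_def free_space_def)
  qed
  moreover have "loop_virasoro_bracket x (y + z) = loop_virasoro_bracket x y + loop_virasoro_bracket x z"
    and "loop_virasoro_bracket (y + z) x = loop_virasoro_bracket y x + loop_virasoro_bracket z x"
    and "loop_virasoro_bracket x (a *\<^sub>p y) = a *\<^sub>p loop_virasoro_bracket x y"
    and "loop_virasoro_bracket (a *\<^sub>p y) x = a *\<^sub>p loop_virasoro_bracket y x"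
    and "loop_virasoro_bracket x x = 0"
    and "loop_virasoro_bracket x (loop_virasoro_bracket y z) + loop_virasoro_bracket y (loop_virasoro_bracket z x) +
      loop_virasoro_bracket z (loop_virasoro_bracket x y) = 0" for a :: 'a and x y z :: "'a \<times> int \<Rightarrow>\<^sub>0 'a"
    unfolding loop_virasoro_bracket_def D_add D_diff D_scale leibniz unfolding c by (simp_all add: algebra_simps)
  ultimately show ?thesis
    by (auto simp only: lie_algebra_def linear_on_def image_subset_iff)
qed

end

theory Submission
  imports Defs
begin

text \<open>
  The compatibility of cobracket and bracket says that \<open>\<Delta>\<close> is a derivation of \<open>L\<close> with values in \<open>L \<otimes> L\<close>.
  The heart of the proof is that every such derivation is inner, and the only part of \<open>L\<close> needed to
  see this is the Witt algebra spanned by \<open>L\<^sub>n = L\<^sub>n\<^sub>,\<^sub>0\<close> with \<open>n\<close> an integer, for which the exponents of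
  \<open>t\<close> and the integer cosets of \<open>\<Gamma>\<close> are mere labels.

  \<^item> On the Witt algebra a derivation is inner (\<open>witt_cocycle_coboundary\<close>).  Subtracting an inner
  derivation makes it vanish on \<open>L\<^sub>0\<close>, hence homogeneous of weight 0, and it then splits into
  independent pieces, one for each label; such a piece is a family of finitely supported sequences
  indexed by a coset \<open>c + \<int>\<close>.  Reducing the value at \<open>L\<^sub>1\<close> modulo the image of \<open>L\<^sub>1\<close> to very few points,
  the relations among \<open>L\<^sub>1, L\<^sub>-\<^sub>1, L\<^sub>2, L\<^sub>-\<^sub>2\<close> and finiteness of supports force the piece to be a coboundary
  (\<open>weight_cocycle_coboundary\<close>).

  \<^item> A derivation that vanishes on the Witt algebra commutes with its action on \<open>L\<close> and
  \<open>L \<otimes> L\<close>, and there is no nonzero such map (\<open>witt_intertwiner_eq_0\<close>): applying \<open>L\<^sub>-\<^sub>n L\<^sub>n\<close> to a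
  tensor \<open>v\<close> produces terms in which one factor is moved up by \<open>n\<close> and the other one down by \<open>n\<close>; for
  generic \<open>n\<close> they lie outside the support of \<open>v\<close>, while \<open>L\<^sub>-\<^sub>n L\<^sub>n\<close> acts on \<open>L\<^sub>\<beta>\<close> as a scalar.

  Thus \<open>\<Delta> x = x \<cdot> r\<close>.  The same genericity argument shows that \<open>L \<otimes> L\<close> and \<open>L \<otimes> L \<otimes> L\<close> contain no nonzero
  invariants of the Witt algebra.  Skewness of \<open>\<Delta>\<close> makes \<open>r + \<tau>(r)\<close> invariant, so \<open>r\<close> is skew.  For
  skew \<open>r\<close> the co-Jacobi identity at \<open>x\<close> reads \<open>x \<cdot> c(r) = 0\<close> (\<open>act3_yb_eq_0\<close>), so \<open>c(r)\<close>, formed in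
  \<open>L \<otimes> L \<otimes> L\<close>, vanishes; its image in \<open>U(L) \<otimes> U(L) \<otimes> U(L)\<close> then vanishes too.
\<close>

section \<open>Multilinear maps on spaces with a basis\<close>

lemma free_space_UNIV [simp]: "free_space UNIV = UNIV"
  by (simp add: free_space_def)

lemma free_space_induct [consumes 1, case_names basis zero add scale]:
  fixes f :: "'b \<Rightarrow>\<^sub>0 'a::field"
  assumes f: "f \<in> free_space B"
    and "\<And>b. b \<in> B \<Longrightarrow> P (Poly_Mapping.single b 1)" and "P 0"
    and "\<And>f g. P f \<Longrightarrow> P g \<Longrightarrow> P (f + g)" and "\<And>c f. P f \<Longrightarrow> P (c *\<^sub>p f)"
  shows "P f"
proof -
  have "P (\<Sum>b\<in>S. Poly_Mapping.lookup f b *\<^sub>p Poly_Mapping.single b 1)" if "finite S" "S \<subseteq> B" for S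
    using that by (induction S rule: finite_induct) (auto simp del: scale_single intro!: assms)
  from this[of "Poly_Mapping.keys f"] f show ?thesis
    by (simp add: free_space_def lin_ext_def[symmetric] lin_ext_basis del: scale_single)
qed

lemmas basis_induct [case_names basis zero add scale] =
  free_space_induct[of _ UNIV, unfolded free_space_UNIV, OF UNIV_I]

lemma free_space_bilinear_induct [consumes 2, case_names basis add_left scale_left zero_left add_right scale_right zero_right]:
  fixes r :: "'b \<Rightarrow>\<^sub>0 'a::field" and s :: "'c \<Rightarrow>\<^sub>0 'a"
  assumes "r \<in> free_space B" "s \<in> free_space C"
    and "\<And>p q. p \<in> B \<Longrightarrow> q \<in> C \<Longrightarrow> P (Poly_Mapping.single p 1) (Poly_Mapping.single q 1)"
    and "\<And>r r' s. P r s \<Longrightarrow> P r' s \<Longrightarrow> P (r + r') s" and "\<And>c r s. P r s \<Longrightarrow> P (c *\<^sub>p r) s" and "\<And>s. P 0 s"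
    and "\<And>r s s'. P r s \<Longrightarrow> P r s' \<Longrightarrow> P r (s + s')" and "\<And>c r s. P r s \<Longrightarrow> P r (c *\<^sub>p s)" and "\<And>r. P r 0"
  shows "P r s"
  using assms(1)
proof (induction r rule: free_space_induct)
  case (basis p)
  show ?case
    using assms(2) by (induction s rule: free_space_induct) (blast intro: assms basis)+
qed (blast intro: assms)+

lemma tensor_zero [simp]: "0 \<otimes>\<^sub>F g = 0" "f \<otimes>\<^sub>F 0 = 0"
  by (simp_all add: tensor_def lin_ext_def)

lemma tensor_uminus: "(- f) \<otimes>\<^sub>F g = - (f \<otimes>\<^sub>F g)" "f \<otimes>\<^sub>F (- g) = - (f \<otimes>\<^sub>F g)"
  using tensor_scale_left[of "- 1" f g] tensor_scale_right[of f "- 1" g] by simp_all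

lemma tensor_diff: "(f - f') \<otimes>\<^sub>F g = f \<otimes>\<^sub>F g - f' \<otimes>\<^sub>F g" "f \<otimes>\<^sub>F (g - g') = f \<otimes>\<^sub>F g - f \<otimes>\<^sub>F g'"
  using tensor_add_left[of f "- f'" g] tensor_add_right[of f g "- g'"] by (simp_all add: tensor_uminus)

lemmas tensor_linear = tensor_add_left tensor_add_right tensor_scale_left tensor_scale_right
  tensor_uminus tensor_diff

lemma lin_ext_uminus [simp]: "lin_ext \<phi> (- f) = - lin_ext \<phi> f"
  using lin_ext_scale[of \<phi> "- 1" f] by simp

lemma lin_ext_diff [simp]: "lin_ext \<phi> (f - g) = lin_ext \<phi> f - lin_ext \<phi> g"
  using lin_ext_add[of \<phi> f "- g"] by simp

lemma lin_ext_pointwise: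
  "lin_ext (\<lambda>b. \<phi> b + \<psi> b) f = lin_ext \<phi> f + lin_ext \<psi> f"
  "lin_ext (\<lambda>b. c *\<^sub>p \<phi> b) f = c *\<^sub>p lin_ext \<phi> f"
  "lin_ext (\<lambda>b. 0) f = 0"
  by (simp_all add: lin_ext_def pm.scale_right_distrib sum.distrib pm.scale_sum_right mult.commute)

definition lin_ext2 :: "('b \<Rightarrow> 'c \<Rightarrow> ('d \<Rightarrow>\<^sub>0 'a::field)) \<Rightarrow> ('b \<Rightarrow>\<^sub>0 'a) \<Rightarrow> ('c \<Rightarrow>\<^sub>0 'a) \<Rightarrow> ('d \<Rightarrow>\<^sub>0 'a)"
  where "lin_ext2 \<phi> r s = lin_ext (\<lambda>p. lin_ext (\<phi> p) s) r"

lemma lin_ext2_linear [simp]: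
  "lin_ext2 \<phi> (r + r') s = lin_ext2 \<phi> r s + lin_ext2 \<phi> r' s"
  "lin_ext2 \<phi> r (s + s') = lin_ext2 \<phi> r s + lin_ext2 \<phi> r s'"
  "lin_ext2 \<phi> (c *\<^sub>p r) s = c *\<^sub>p lin_ext2 \<phi> r s"
  "lin_ext2 \<phi> r (c *\<^sub>p s) = c *\<^sub>p lin_ext2 \<phi> r s"
  "lin_ext2 \<phi> 0 s = 0" "lin_ext2 \<phi> r 0 = 0"
  "lin_ext2 \<phi> (- r) s = - lin_ext2 \<phi> r s" "lin_ext2 \<phi> r (- s) = - lin_ext2 \<phi> r s"
proof -
  show scale: "lin_ext2 \<phi> r (c *\<^sub>p s) = c *\<^sub>p lin_ext2 \<phi> r s" for c s
    by (simp add: lin_ext2_def lin_ext_pointwise)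
  show "lin_ext2 \<phi> r (- s) = - lin_ext2 \<phi> r s" using scale[of "- 1" s] by simp
qed (simp_all add: lin_ext2_def lin_ext_pointwise)

lemma lin_ext2_basis [simp]:
  "lin_ext2 \<phi> (Poly_Mapping.single p 1) (Poly_Mapping.single q 1) = \<phi> p q"
  by (simp add: lin_ext2_def)

lemma lin_ext2_tensor:
  fixes h :: "('b \<Rightarrow>\<^sub>0 'a::field) \<Rightarrow> ('b \<Rightarrow>\<^sub>0 'a) \<Rightarrow> ('b \<Rightarrow>\<^sub>0 'a) \<Rightarrow> ('b \<Rightarrow>\<^sub>0 'a) \<Rightarrow> ('d \<Rightarrow>\<^sub>0 'a)"
  assumes "\<And>x y f g k. h (x + y) f g k = h x f g k + h y f g k" "\<And>c x f g k. h (c *\<^sub>p x) f g k = c *\<^sub>p h x f g k"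
    "\<And>x y f g k. h f (x + y) g k = h f x g k + h f y g k" "\<And>c x f g k. h f (c *\<^sub>p x) g k = c *\<^sub>p h f x g k"
    "\<And>x y f g k. h f g (x + y) k = h f g x k + h f g y k" "\<And>c x f g k. h f g (c *\<^sub>p x) k = c *\<^sub>p h f g x k"
    "\<And>x y f g k. h f g k (x + y) = h f g k x + h f g k y" "\<And>c x f g k. h f g k (c *\<^sub>p x) = c *\<^sub>p h f g k x"
  shows "lin_ext2 (\<lambda>(a, b) (a', b'). h (Poly_Mapping.single a 1) (Poly_Mapping.single b 1)
      (Poly_Mapping.single a' 1) (Poly_Mapping.single b' 1)) (f \<otimes>\<^sub>F g) (f' \<otimes>\<^sub>F g') = h f g f' g'"
proof -
  have "lin_ext (\<lambda>(a', b'). h x y (Poly_Mapping.single a' 1) (Poly_Mapping.single b' 1)) (f' \<otimes>\<^sub>F g') = h x y f' g'" for x y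
    by (rule tensor_universal[symmetric]) (rule assms)+
  then have "lin_ext2 (\<lambda>(a, b) (a', b'). h (Poly_Mapping.single a 1) (Poly_Mapping.single b 1)
      (Poly_Mapping.single a' 1) (Poly_Mapping.single b' 1)) (f \<otimes>\<^sub>F g) (f' \<otimes>\<^sub>F g') =
      lin_ext (\<lambda>(a, b). h (Poly_Mapping.single a 1) (Poly_Mapping.single b 1) f' g') (f \<otimes>\<^sub>F g)"
    unfolding lin_ext2_def by (simp add: case_prod_beta')
  also have "\<dots> = h f g f' g'"
    by (rule tensor_universal[of "\<lambda>x y. h x y f' g'", symmetric]) (rule assms)+
  finally show ?thesis .
qed

lemma bilinear_tensor_induct [case_names tensor add_left scale_left zero_left add_right scale_right zero_right]:
  fixes r :: "'c \<times> 'c \<Rightarrow>\<^sub>0 'a::field" and s :: "'d \<times> 'd \<Rightarrow>\<^sub>0 'a"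
  assumes "\<And>f g f' g'. P (f \<otimes>\<^sub>F g) (f' \<otimes>\<^sub>F g')"
    and "\<And>r r' s. P r s \<Longrightarrow> P r' s \<Longrightarrow> P (r + r') s" and "\<And>c r s. P r s \<Longrightarrow> P (c *\<^sub>p r) s" and "\<And>s. P 0 s"
    and "\<And>r s s'. P r s \<Longrightarrow> P r s' \<Longrightarrow> P r (s + s')" and "\<And>c r s. P r s \<Longrightarrow> P r (c *\<^sub>p s)" and "\<And>r. P r 0"
  shows "P r s"
proof (induction r rule: basis_induct)
  case (basis p)
  show ?case
  proof (induction s rule: basis_induct)
    case (basis q)
    show ?case
      using assms(1)[of "Poly_Mapping.single (fst p) 1" "Poly_Mapping.single (snd p) 1"
          "Poly_Mapping.single (fst q) 1" "Poly_Mapping.single (snd q) 1"] by simp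
  qed (rule assms; assumption)+
qed (rule assms; assumption)+

lemma twist_linear [simp]:
  "twist (f + g) = twist f + twist g" "twist (c *\<^sub>p f) = c *\<^sub>p twist f" "twist 0 = 0"
  "twist (- f) = - twist f"
  by (simp_all add: twist_def)

lemma twist_diff: "twist (f - g) = twist f - twist g"
  by (simp add: twist_def)

lemma twist_basis [simp]: "twist (Poly_Mapping.single (a, b) 1) = Poly_Mapping.single (b, a) 1"
  by (simp add: twist_def)

lemma twist_twist [simp]: "twist (twist f) = f"
proof (induction f rule: basis_induct)
  case (basis p)
  then show ?case by (cases p) simp
qed simp_all

lemma cycle3_linear [simp]:
  "cycle3 (f + g) = cycle3 f + cycle3 g" "cycle3 (c *\<^sub>p f) = c *\<^sub>p cycle3 f" "cycle3 0 = 0"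
  "cycle3 (- f) = - cycle3 f"
  by (simp_all add: cycle3_def)

lemma cycle3_tensor: "cycle3 (f \<otimes>\<^sub>F g \<otimes>\<^sub>F h) = g \<otimes>\<^sub>F h \<otimes>\<^sub>F f"
proof (induction f rule: basis_induct)
  case (basis a)
  show ?case
  proof (induction g rule: basis_induct)
    case (basis b)
    show ?case
    proof (induction h rule: basis_induct)
      case (basis c)
      show ?case by (simp add: cycle3_def)
    qed (simp_all add: tensor_linear)
  qed (simp_all add: tensor_linear)
qed (simp_all add: tensor_linear)

lemma diag_action_add: "diag_action br x (u + v) = diag_action br x u + diag_action br x v"
  and diag_action_scale: "diag_action br x (c *\<^sub>p v) = c *\<^sub>p diag_action br x v"
  by (simp_all add: diag_action_def)

lemma diag_action_zero [simp]: "diag_action br x 0 = 0"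
  by (simp add: diag_action_def)

lemma diag_action_uminus: "diag_action br x (- v) = - diag_action br x v"
  using diag_action_scale[of br x "- 1" v] by simp

lemma diag_action_diff: "diag_action br x (u - v) = diag_action br x u - diag_action br x v"
  using diag_action_add[of br x u "- v"] by (simp add: diag_action_uminus)

section \<open>The co-Jacobi identity of a coboundary Lie coalgebra\<close>

definition act3 :: "('b, 'a::field) bracket \<Rightarrow> ('b \<Rightarrow>\<^sub>0 'a) \<Rightarrow> ('b \<times> 'b \<times> 'b \<Rightarrow>\<^sub>0 'a) \<Rightarrow> ('b \<times> 'b \<times> 'b \<Rightarrow>\<^sub>0 'a)"
  where "act3 br x = lin_ext (\<lambda>(a, b, c).
    let a = Poly_Mapping.single a 1; b = Poly_Mapping.single b 1; c = Poly_Mapping.single c 1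
    in br x a \<otimes>\<^sub>F b \<otimes>\<^sub>F c + a \<otimes>\<^sub>F br x b \<otimes>\<^sub>F c + a \<otimes>\<^sub>F b \<otimes>\<^sub>F br x c)"

lemma act3_linear [simp]:
  "act3 br x (f + g) = act3 br x f + act3 br x g" "act3 br x (c *\<^sub>p f) = c *\<^sub>p act3 br x f"
  "act3 br x 0 = 0"
  by (simp_all add: act3_def)

text \<open>
  The three summands \<open>[r\<^sup>1\<^sup>2, s\<^sup>1\<^sup>3]\<close>, \<open>[r\<^sup>1\<^sup>2, s\<^sup>2\<^sup>3]\<close>, \<open>[r\<^sup>1\<^sup>3, s\<^sup>2\<^sup>3]\<close> of the classical Yang-Baxter expression can be
  formed in \<open>L \<otimes> L \<otimes> L\<close>, because in each of them the brackets occur in one tensor factor only.  They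
  are kept bilinear in \<open>(r, s)\<close>, so that differentiating \<open>c(r)\<close> amounts to replacing one argument
  at a time.
\<close>

definition yb12_13 :: "('b, 'a::field) bracket \<Rightarrow> ('b \<times> 'b \<Rightarrow>\<^sub>0 'a) \<Rightarrow> ('b \<times> 'b \<Rightarrow>\<^sub>0 'a) \<Rightarrow> ('b \<times> 'b \<times> 'b \<Rightarrow>\<^sub>0 'a)"
  where "yb12_13 br = lin_ext2 (\<lambda>(a, b) (a', b').
    br (Poly_Mapping.single a 1) (Poly_Mapping.single a' 1) \<otimes>\<^sub>F
      Poly_Mapping.single b 1 \<otimes>\<^sub>F Poly_Mapping.single b' 1)"

definition yb12_23 :: "('b, 'a::field) bracket \<Rightarrow> ('b \<times> 'b \<Rightarrow>\<^sub>0 'a) \<Rightarrow> ('b \<times> 'b \<Rightarrow>\<^sub>0 'a) \<Rightarrow> ('b \<times> 'b \<times> 'b \<Rightarrow>\<^sub>0 'a)"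
  where "yb12_23 br = lin_ext2 (\<lambda>(a, b) (a', b').
    Poly_Mapping.single a 1 \<otimes>\<^sub>F br (Poly_Mapping.single b 1) (Poly_Mapping.single a' 1) \<otimes>\<^sub>F
      Poly_Mapping.single b' 1)"

definition yb13_23 :: "('b, 'a::field) bracket \<Rightarrow> ('b \<times> 'b \<Rightarrow>\<^sub>0 'a) \<Rightarrow> ('b \<times> 'b \<Rightarrow>\<^sub>0 'a) \<Rightarrow> ('b \<times> 'b \<times> 'b \<Rightarrow>\<^sub>0 'a)"
  where "yb13_23 br = lin_ext2 (\<lambda>(a, b) (a', b').
    Poly_Mapping.single a 1 \<otimes>\<^sub>F Poly_Mapping.single a' 1 \<otimes>\<^sub>F
      br (Poly_Mapping.single b 1) (Poly_Mapping.single b' 1))"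

definition yb :: "('b, 'a::field) bracket \<Rightarrow> ('b \<times> 'b \<Rightarrow>\<^sub>0 'a) \<Rightarrow> ('b \<times> 'b \<Rightarrow>\<^sub>0 'a) \<Rightarrow> ('b \<times> 'b \<times> 'b \<Rightarrow>\<^sub>0 'a)"
  where "yb br r s = yb12_13 br r s + yb12_23 br r s + yb13_23 br r s"

locale total_lie_algebra =
  fixes br :: "('b, 'a::field) bracket"
  assumes lie: "lie_algebra UNIV br"
begin

lemma bracket_linear [simp]:
  "br x (y + z) = br x y + br x z" "br (y + z) x = br y x + br z x"
  "br x (c *\<^sub>p y) = c *\<^sub>p br x y" "br (c *\<^sub>p y) x = c *\<^sub>p br y x"
  using lie by (auto simp: lie_algebra_def linear_on_def)

lemma bracket_zero [simp]: "br x 0 = 0" "br 0 x = 0"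
  using bracket_linear(3)[of x 0 0] bracket_linear(4)[of 0 0 x] by simp_all

lemma bracket_uminus [simp]: "br x (- y) = - br x y" "br (- y) x = - br y x"
  using bracket_linear(3)[of x "- 1" y] bracket_linear(4)[of "- 1" y x] by simp_all

lemma bracket_antisym: "br y x = - br x y"
proof -
  have "br (x + y) (x + y) = 0" "br x x = 0" "br y y = 0"
    using lie unfolding lie_algebra_def by auto
  then show ?thesis by (simp add: add_eq_0_iff)
qed

lemma bracket_jacobi: "br x (br y z) = br (br x y) z + br y (br x z)"
proof -
  have "br x (br y z) + br y (br z x) + br z (br x y) = 0"
    using lie unfolding lie_algebra_def by auto
  moreover have "br y (br z x) = - br y (br x z)" "br z (br x y) = - br (br x y) z"
    using bracket_antisym[of z x] bracket_antisym[of z "br x y"] by simp_all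
  ultimately show ?thesis by (simp add: algebra_simps)
qed

lemma diag_action_tensor: "diag_action br x (f \<otimes>\<^sub>F g) = br x f \<otimes>\<^sub>F g + f \<otimes>\<^sub>F br x g"
  unfolding diag_action_def
  by (subst tensor_universal[of "\<lambda>f g. br x f \<otimes>\<^sub>F g + f \<otimes>\<^sub>F br x g" f g])
     (simp_all add: tensor_linear pm.scale_right_distrib)

lemma diag_action_left:
  "diag_action br (x + y) r = diag_action br x r + diag_action br y r"
  "diag_action br (c *\<^sub>p x) r = c *\<^sub>p diag_action br x r"
proof (induction r rule: basis_induct)
  case (basis p)
  obtain a b where p: "p = (a, b)" by force
  { case 1 show ?case by (simp add: p diag_action_tensor tensor_linear flip: tensor_single)
  next case 2 show ?case
      by (simp add: p diag_action_tensor tensor_linear pm.scale_right_distrib flip: tensor_single) }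
qed (simp_all add: diag_action_add diag_action_scale pm.scale_right_distrib mult.commute)

lemma twist_diag_action: "twist (diag_action br x r) = diag_action br x (twist r)"
proof (induction r rule: basis_induct)
  case (basis p)
  obtain a b where p: "p = (a, b)" by force
  show ?case
    by (simp add: p diag_action_tensor twist_tensor flip: tensor_single)
qed (simp_all add: diag_action_add diag_action_scale)

lemma diag_action_bracket:
  "diag_action br (br x y) r = diag_action br x (diag_action br y r) - diag_action br y (diag_action br x r)"
proof (induction r rule: basis_induct)
  case (basis p)
  obtain a b where p: "p = (a, b)" by force
  have j: "br (br x y) z = br x (br y z) - br y (br x z)" for z
    using bracket_jacobi[of x y z] by simp
  show ?case
    by (simp add: p diag_action_tensor diag_action_add j tensor_linear flip: tensor_single)
qed (simp_all add: diag_action_add diag_action_scale pm.scale_right_diff_distrib)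

lemma act3_tensor:
  "act3 br x (f \<otimes>\<^sub>F g \<otimes>\<^sub>F h) = br x f \<otimes>\<^sub>F g \<otimes>\<^sub>F h + f \<otimes>\<^sub>F br x g \<otimes>\<^sub>F h + f \<otimes>\<^sub>F g \<otimes>\<^sub>F br x h"
proof (induction f rule: basis_induct)
  case (basis a)
  show ?case
  proof (induction g rule: basis_induct)
    case (basis b)
    show ?case
    proof (induction h rule: basis_induct)
      case (basis c)
      show ?case by (simp add: act3_def Let_def)
    qed (simp_all add: tensor_linear pm.scale_right_distrib)
  qed (simp_all add: tensor_linear pm.scale_right_distrib)
qed (simp_all add: tensor_linear pm.scale_right_distrib)

lemma yb_tensor:
  "yb12_13 br (f \<otimes>\<^sub>F g) (f' \<otimes>\<^sub>F g') = br f f' \<otimes>\<^sub>F g \<otimes>\<^sub>F g'"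
  "yb12_23 br (f \<otimes>\<^sub>F g) (f' \<otimes>\<^sub>F g') = f \<otimes>\<^sub>F br g f' \<otimes>\<^sub>F g'"
  "yb13_23 br (f \<otimes>\<^sub>F g) (f' \<otimes>\<^sub>F g') = f \<otimes>\<^sub>F f' \<otimes>\<^sub>F br g g'"
  unfolding yb12_13_def yb12_23_def yb13_23_def
  by (rule lin_ext2_tensor; simp add: tensor_linear)+

lemma yb_linear [simp]:
  "yb12_13 br (r + r') s = yb12_13 br r s + yb12_13 br r' s"
  "yb12_13 br r (s + s') = yb12_13 br r s + yb12_13 br r s'"
  "yb12_13 br (c *\<^sub>p r) s = c *\<^sub>p yb12_13 br r s" "yb12_13 br r (c *\<^sub>p s) = c *\<^sub>p yb12_13 br r s"
  "yb12_13 br 0 s = 0" "yb12_13 br r 0 = 0"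
  "yb12_13 br (- r) s = - yb12_13 br r s" "yb12_13 br r (- s) = - yb12_13 br r s"
  "yb12_23 br (r + r') s = yb12_23 br r s + yb12_23 br r' s"
  "yb12_23 br r (s + s') = yb12_23 br r s + yb12_23 br r s'"
  "yb12_23 br (c *\<^sub>p r) s = c *\<^sub>p yb12_23 br r s" "yb12_23 br r (c *\<^sub>p s) = c *\<^sub>p yb12_23 br r s"
  "yb12_23 br 0 s = 0" "yb12_23 br r 0 = 0"
  "yb12_23 br (- r) s = - yb12_23 br r s" "yb12_23 br r (- s) = - yb12_23 br r s"
  "yb13_23 br (r + r') s = yb13_23 br r s + yb13_23 br r' s"
  "yb13_23 br r (s + s') = yb13_23 br r s + yb13_23 br r s'"
  "yb13_23 br (c *\<^sub>p r) s = c *\<^sub>p yb13_23 br r s" "yb13_23 br r (c *\<^sub>p s) = c *\<^sub>p yb13_23 br r s"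
  "yb13_23 br 0 s = 0" "yb13_23 br r 0 = 0"
  "yb13_23 br (- r) s = - yb13_23 br r s" "yb13_23 br r (- s) = - yb13_23 br r s"
  by (simp_all add: yb12_13_def yb12_23_def yb13_23_def)

text \<open>
  The cyclic rotation permutes the three summands up to twists of the arguments; in the second and
  third case the arguments also change places, which reverses the bracket and costs the sign.
\<close>

lemma cycle3_yb:
  "cycle3 (yb12_13 br r s) = yb13_23 br (twist r) (twist s)"
  "cycle3 (yb12_23 br r s) = - yb12_13 br s (twist r)"
  "cycle3 (yb13_23 br r s) = - yb12_23 br s (twist r)"
proof (induction r s rule: bilinear_tensor_induct)
  case (tensor f g f' g')
  { case 1 show ?case by (simp add: yb_tensor cycle3_tensor twist_tensor)
  next case 2 show ?case
      using bracket_antisym[of g f'] by (simp add: yb_tensor cycle3_tensor twist_tensor tensor_uminus)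
  next case 3 show ?case
      using bracket_antisym[of g g'] by (simp add: yb_tensor cycle3_tensor twist_tensor tensor_uminus)
  }
qed simp_all

lemma act3_yb_parts:
  "act3 br x (yb12_13 br r s) = yb12_13 br (diag_action br x r) s + yb12_13 br r (diag_action br x s)"
  "act3 br x (yb12_23 br r s) = yb12_23 br (diag_action br x r) s + yb12_23 br r (diag_action br x s)"
  "act3 br x (yb13_23 br r s) = yb13_23 br (diag_action br x r) s + yb13_23 br r (diag_action br x s)"
proof (induction r s rule: bilinear_tensor_induct)
  case (tensor f g f' g')
  { case 1 show ?case
      by (simp add: yb_tensor act3_tensor diag_action_tensor bracket_jacobi[of x f f'] tensor_linear)
  next case 2 show ?case
      by (simp add: yb_tensor act3_tensor diag_action_tensor bracket_jacobi[of x g f'] tensor_linear)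
  next case 3 show ?case
      by (simp add: yb_tensor act3_tensor diag_action_tensor bracket_jacobi[of x g g'] tensor_linear)
  }
qed (simp_all add: diag_action_add diag_action_scale pm.scale_right_distrib)

lemma act3_yb:
  "act3 br x (yb br r r) = yb br (diag_action br x r) r + yb br r (diag_action br x r)"
  by (simp add: yb_def act3_yb_parts)

text \<open>
  For skew tensors the signs and twists of \<open>cycle3_yb\<close> cancel, and the six terms of the cyclic sum
  are the six terms of the symmetrised Yang-Baxter expression.
\<close>

lemma cyclic_sum_yb:
  assumes r: "twist r = - r" and s: "twist s = - s"
    and w: "w = yb12_23 br s r + yb13_23 br s r"
  shows "w + cycle3 w + cycle3 (cycle3 w) = yb br s r + yb br r s"
  by (simp add: w cycle3_yb r s yb_def)

text \<open>
  The expression \<open>(1 \<otimes> \<Delta>) s\<close> contains only those two of the three summands in which the bracket involves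
  the second factor of \<open>s\<close>; the third one is supplied by the cyclic rotations.
\<close>

lemma id_tensor_coboundary:
  assumes "s \<in> free_space (B \<times> B)"
    and \<Delta>: "\<And>b. b \<in> B \<Longrightarrow> \<Delta> (Poly_Mapping.single b 1) = diag_action br (Poly_Mapping.single b 1) r"
  shows "id_tensor \<Delta> s = yb12_23 br s r + yb13_23 br s r"
proof -
  have "f \<otimes>\<^sub>F diag_action br g r = yb12_23 br (f \<otimes>\<^sub>F g) r + yb13_23 br (f \<otimes>\<^sub>F g) r" for f g
  proof (induction r rule: basis_induct)
    case (basis p)
    obtain a b where p: "p = (a, b)" by force
    show ?case by (simp add: p diag_action_tensor yb_tensor tensor_linear flip: tensor_single)
  qed (simp_all add: diag_action_add diag_action_scale tensor_linear pm.scale_right_distrib)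
  note eq = this[of "Poly_Mapping.single _ 1" "Poly_Mapping.single _ 1"]
  show ?thesis
    using assms(1)
  proof (induction s rule: free_space_induct)
    case (basis p)
    then show ?case by (auto simp: id_tensor_def \<Delta> eq)
  qed (simp_all add: id_tensor_def pm.scale_right_distrib)
qed

text \<open>
  With \<open>s = \<Delta> x = x \<cdot> r\<close> the co-Jacobi identity becomes \<open>c(x \<cdot> r, r) + c(r, x \<cdot> r) = 0\<close>, and the left-hand side
  is the derivative \<open>x \<cdot> c(r, r)\<close>.
\<close>

theorem act3_yb_eq_0:
  assumes co: "lie_coalgebra B \<Delta>"
    and r: "twist r = - r"
    and \<Delta>: "\<And>x. x \<in> free_space B \<Longrightarrow> \<Delta> x = diag_action br x r" and x: "x \<in> free_space B"
  shows "act3 br x (yb br r r) = 0"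
proof -
  have "\<Delta> ` free_space B \<subseteq> free_space (B \<times> B)"
    and cojacobi: "\<forall>x\<in>free_space B. let w = id_tensor \<Delta> (\<Delta> x) in w + cycle3 w + cycle3 (cycle3 w) = 0"
    using co by (simp_all add: lie_coalgebra_def linear_on_def)
  with x have "\<Delta> x \<in> free_space (B \<times> B)" by auto
  moreover have "Poly_Mapping.single b 1 \<in> free_space B" if "b \<in> B" for b
    using that by (simp add: free_space_def)
  ultimately have w: "id_tensor \<Delta> (\<Delta> x) = yb12_23 br (\<Delta> x) r + yb13_23 br (\<Delta> x) r"
    by (intro id_tensor_coboundary \<Delta>)
  have "twist (\<Delta> x) = - \<Delta> x"
    by (simp add: \<Delta>[OF x] twist_diag_action r diag_action_uminus)
  from cyclic_sum_yb[OF r this w] have "yb br (\<Delta> x) r + yb br r (\<Delta> x) = 0"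
    using bspec[OF cojacobi x] by (simp only: Let_def)
  then show ?thesis by (simp add: act3_yb \<Delta>[OF x])
qed

end

section \<open>From the triple tensor product to the enveloping algebra\<close>

text \<open>
  The inclusion of \<open>L \<otimes> L \<otimes> L\<close> into \<open>T(L) \<otimes> T(L) \<otimes> T(L)\<close>.
\<close>

definition word3 :: "('b \<times> 'b \<times> 'b \<Rightarrow>\<^sub>0 'a::field) \<Rightarrow> ('b list \<times> 'b list \<times> 'b list \<Rightarrow>\<^sub>0 'a)"
  where "word3 = lin_ext (\<lambda>(a, b, c). Poly_Mapping.single ([a], [b], [c]) 1)"

lemma letter_linear [simp]:
  "letter (f + g) = letter f + letter g" "letter (c *\<^sub>p f) = c *\<^sub>p letter f" "letter 0 = 0"
  by (simp_all add: letter_def)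

lemma letter_basis [simp]: "letter (Poly_Mapping.single b 1) = Poly_Mapping.single [b] 1"
  by (simp add: letter_def)

lemma word3_linear [simp]:
  "word3 (f + g) = word3 f + word3 g" "word3 (c *\<^sub>p f) = c *\<^sub>p word3 f" "word3 0 = 0"
  by (simp_all add: word3_def)

lemma word3_tensor: "word3 (f \<otimes>\<^sub>F g \<otimes>\<^sub>F h) = letter f \<otimes>\<^sub>F letter g \<otimes>\<^sub>F letter h"
proof (induction f rule: basis_induct)
  case (basis a)
  show ?case
  proof (induction g rule: basis_induct)
    case (basis b)
    show ?case
    proof (induction h rule: basis_induct)
      case (basis c)
      show ?case by (simp add: word3_def)
    qed (simp_all add: tensor_linear)
  qed (simp_all add: tensor_linear)
qed (simp_all add: tensor_linear)

lemma scale_pm_mult: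
  fixes f g :: "'b::monoid_add \<Rightarrow>\<^sub>0 'a::field"
  shows "(c *\<^sub>p f) * g = c *\<^sub>p (f * g)" "f * (c *\<^sub>p g) = c *\<^sub>p (f * g)"
proof -
  have "(c *\<^sub>p f) * g = c *\<^sub>p (f * g) \<and> f * (c *\<^sub>p g) = c *\<^sub>p (f * g)"
  proof (induction f rule: single_add_induct)
    case (single b x)
    show ?case
      by (induction g rule: single_add_induct)
         (simp_all add: mult_single pm.scale_right_distrib distrib_left mult.assoc mult.left_commute)
  qed (simp add: pm.scale_right_distrib distrib_right)
  then show "(c *\<^sub>p f) * g = c *\<^sub>p (f * g)" "f * (c *\<^sub>p g) = c *\<^sub>p (f * g)" by blast+
qed

lemma commutator_linear [simp]:
  fixes f g h :: "'b::monoid_add \<Rightarrow>\<^sub>0 'a::field"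
  shows "commutator (f + g) h = commutator f h + commutator g h"
    "commutator h (f + g) = commutator h f + commutator h g"
    "commutator (c *\<^sub>p f) h = c *\<^sub>p commutator f h" "commutator h (c *\<^sub>p f) = c *\<^sub>p commutator h f"
    "commutator 0 h = 0" "commutator h 0 = 0"
  by (simp_all add: commutator_def distrib_left distrib_right scale_pm_mult pm.scale_right_diff_distrib)

lemma r_linear [simp]:
  "r12 (f + g) = r12 f + r12 g" "r12 (c *\<^sub>p f) = c *\<^sub>p r12 f" "r12 0 = 0"
  "r13 (f + g) = r13 f + r13 g" "r13 (c *\<^sub>p f) = c *\<^sub>p r13 f" "r13 0 = 0"
  "r23 (f + g) = r23 f + r23 g" "r23 (c *\<^sub>p f) = c *\<^sub>p r23 f" "r23 0 = 0"
  by (simp_all add: r12_def r13_def r23_def)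

lemma env_ideal_relation:
  assumes "x \<in> free_space B" "y \<in> free_space B"
  shows "commutator (letter x) (letter y) - letter (br x y) \<in> env_ideal B br"
proof -
  have "1 \<in> free_space (lists B)"
    by (simp add: free_space_def zero_list_def flip: single_one)
  then show ?thesis
    unfolding env_ideal_def using assms
    by (intro pm.span_base CollectI exI[of _ 1] exI[of _ x] exI[of _ y]) simp
qed

lemma env3_ideal_relation:
  assumes "j \<in> env_ideal B br" "u \<in> free_space (lists B)" "v \<in> free_space (lists B)"
  shows "j \<otimes>\<^sub>F u \<otimes>\<^sub>F v \<in> env3_ideal B br" "u \<otimes>\<^sub>F j \<otimes>\<^sub>F v \<in> env3_ideal B br"
    "u \<otimes>\<^sub>F v \<otimes>\<^sub>F j \<in> env3_ideal B br"
  unfolding env3_ideal_def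
  by (rule pm.span_base, rule UN_I[OF assms(1)], rule UN_I[OF assms(2)], rule UN_I[OF assms(3)], simp)+

lemma env3_ideal_closed:
  "x \<in> env3_ideal B br \<Longrightarrow> y \<in> env3_ideal B br \<Longrightarrow> x + y \<in> env3_ideal B br"
  "x \<in> env3_ideal B br \<Longrightarrow> c *\<^sub>p x \<in> env3_ideal B br" "0 \<in> env3_ideal B br"
  unfolding env3_ideal_def by (rule pm.span_add pm.span_scale pm.span_zero; assumption?)+

text \<open>
  In the commutator of \<open>r\<^sup>1\<^sup>2\<close> and \<open>s\<^sup>1\<^sup>3\<close> only the letters in the first tensor factor fail to commute,
  and modulo the defining relations of \<open>U(L)\<close> their commutator is the letter of their bracket;
  likewise for the other two pairs.
\<close>

lemma commutator_mod_env3_ideal: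
  fixes br :: "('b, 'a::field) bracket"
  assumes "total_lie_algebra br" "r \<in> free_space (B \<times> B)" "s \<in> free_space (B \<times> B)"
  shows "commutator (r12 r) (r13 s) - word3 (yb12_13 br r s) \<in> env3_ideal B br"
    and "commutator (r12 r) (r23 s) - word3 (yb12_23 br r s) \<in> env3_ideal B br"
    and "commutator (r13 r) (r23 s) - word3 (yb13_23 br r s) \<in> env3_ideal B br"
proof -
  interpret total_lie_algebra br by fact
  let ?e = "\<lambda>b::'b. Poly_Mapping.single b (1::'a)"
  have "commutator (r12 r) (r13 s) - word3 (yb12_13 br r s) \<in> env3_ideal B br \<and>
      commutator (r12 r) (r23 s) - word3 (yb12_23 br r s) \<in> env3_ideal B br \<and>
      commutator (r13 r) (r23 s) - word3 (yb13_23 br r s) \<in> env3_ideal B br"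
    using assms(2,3)
  proof (induction r s rule: free_space_bilinear_induct)
    case (basis p q)
    let ?p = "Poly_Mapping.single p (1::'a)" and ?q = "Poly_Mapping.single q (1::'a)"
    obtain a b a' b' where pq: "p = (a, b)" "q = (a', b')" by (metis prod.exhaust)
    with basis have B: "a \<in> B" "b \<in> B" "a' \<in> B" "b' \<in> B" by auto
    have J: "commutator (letter (?e x)) (letter (?e y)) - letter (br (?e x) (?e y)) \<in> env_ideal B br"
      if "x \<in> B" "y \<in> B" for x y
      using that by (intro env_ideal_relation) (simp_all add: free_space_def)
    have L: "letter (?e x) \<in> free_space (lists B)" if "x \<in> B" for x
      using that by (simp add: free_space_def)
    have one: "commutator (r12 ?p) (r13 ?q) - word3 (yb12_13 br ?p ?q) =
        (commutator (letter (?e a)) (letter (?e a')) - letter (br (?e a) (?e a'))) \<otimes>\<^sub>F letter (?e b) \<otimes>\<^sub>F letter (?e b')"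
      unfolding pq tensor_single[symmetric] yb_tensor word3_tensor
      by (simp add: r12_def r13_def tensor_mult commutator_def tensor_diff del: letter_basis)
    have two: "commutator (r12 ?p) (r23 ?q) - word3 (yb12_23 br ?p ?q) =
        letter (?e a) \<otimes>\<^sub>F (commutator (letter (?e b)) (letter (?e a')) - letter (br (?e b) (?e a'))) \<otimes>\<^sub>F letter (?e b')"
      unfolding pq tensor_single[symmetric] yb_tensor word3_tensor
      by (simp add: r12_def r23_def tensor_mult commutator_def tensor_diff del: letter_basis)
    have three: "commutator (r13 ?p) (r23 ?q) - word3 (yb13_23 br ?p ?q) =
        letter (?e a) \<otimes>\<^sub>F letter (?e a') \<otimes>\<^sub>F (commutator (letter (?e b)) (letter (?e b')) - letter (br (?e b) (?e b')))"
      unfolding pq tensor_single[symmetric] yb_tensor word3_tensor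
      by (simp add: r13_def r23_def tensor_mult commutator_def tensor_diff del: letter_basis)
    show ?case
      unfolding one two three by (intro conjI env3_ideal_relation J L B)
  qed (simp_all add: add_diff_add env3_ideal_closed flip: pm.scale_right_diff_distrib)
  then show "commutator (r12 r) (r13 s) - word3 (yb12_13 br r s) \<in> env3_ideal B br"
    "commutator (r12 r) (r23 s) - word3 (yb12_23 br r s) \<in> env3_ideal B br"
    "commutator (r13 r) (r23 s) - word3 (yb13_23 br r s) \<in> env3_ideal B br" by blast+
qed

lemma classical_yang_baxterI:
  assumes "total_lie_algebra br" "r \<in> free_space (B \<times> B)" "yb br r r = 0"
  shows "classical_yang_baxter B br r"
proof -
  have "cyb r = (commutator (r12 r) (r13 r) - word3 (yb12_13 br r r)) +
      (commutator (r12 r) (r23 r) - word3 (yb12_23 br r r)) +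
      (commutator (r13 r) (r23 r) - word3 (yb13_23 br r r)) + word3 (yb br r r)"
    by (simp add: cyb_def yb_def)
  also have "\<dots> \<in> env3_ideal B br"
    using assms(3) commutator_mod_env3_ideal[OF assms(1,2,2)] by (simp add: env3_ideal_closed)
  finally show ?thesis by (simp add: classical_yang_baxter_def)
qed

section \<open>The integral Witt algebra acting on tensors\<close>

interpretation loop: total_lie_algebra "loop_virasoro_bracket :: ('a::field \<times> int, 'a) bracket"
proof
  show "lie_algebra UNIV (loop_virasoro_bracket :: ('a \<times> int, 'a) bracket)"
    using loop_virasoro_lie_algebra[of UNIV]
    by (simp add: additive_subgroup_of_field_def loop_virasoro_basis_def)
qed

abbreviation loop_act (infixr "\<bullet>" 75)
  where "loop_act \<equiv> diag_action loop_virasoro_bracket"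

definition witt :: "int \<Rightarrow> ('a \<times> int \<Rightarrow>\<^sub>0 'a::field)"
  where "witt n = Poly_Mapping.single (of_int n, 0) 1"

lemma witt_act_single:
  "witt n \<bullet> Poly_Mapping.single ((a, i), (b, j)) c =
    Poly_Mapping.single ((a + of_int n, i), (b, j)) (c * (a - of_int n)) +
    Poly_Mapping.single ((a, i), (b + of_int n, j)) (c * (b - of_int n))"
  for a b c :: "'a::field"
proof -
  have "Poly_Mapping.single k 1 \<otimes>\<^sub>F Poly_Mapping.single l d = Poly_Mapping.single (k, l) d"
    "Poly_Mapping.single k d \<otimes>\<^sub>F Poly_Mapping.single l 1 = Poly_Mapping.single (k, l) d"
    for k l :: "'a \<times> int" and d :: 'a
    by (simp_all add: tensor_def)
  then show ?thesis
    by (simp add: diag_action_def witt_def loop_virasoro_bracket_basis pm.scale_right_distrib add.commute)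
qed

lemma lookup_witt_act:
  fixes v :: "('a::field \<times> int) \<times> ('a \<times> int) \<Rightarrow>\<^sub>0 'a"
  shows "Poly_Mapping.lookup (witt n \<bullet> v) ((a, i), (b, j)) =
    (a - 2 * of_int n) * Poly_Mapping.lookup v ((a - of_int n, i), (b, j)) +
    (b - 2 * of_int n) * Poly_Mapping.lookup v ((a, i), (b - of_int n, j))"
proof (induction v rule: single_add_induct)
  case (single p c)
  obtain a' i' b' j' where p: "p = ((a', i'), (b', j'))" by (metis prod.exhaust)
  have shift: "x + of_int n = y \<longleftrightarrow> x = y - of_int n" for x y :: 'a by (auto simp: algebra_simps)
  show ?case
    by (simp add: p witt_act_single lookup_add lookup_single when_def shift)
next
  case (add f g)
  then show ?case by (simp add: diag_action_add lookup_add algebra_simps)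
qed

lemma witt_act_commutator:
  fixes v :: "('a::field \<times> int) \<times> ('a \<times> int) \<Rightarrow>\<^sub>0 'a"
  shows "witt m \<bullet> witt n \<bullet> v - witt n \<bullet> witt m \<bullet> v = of_int (n - m) *\<^sub>p (witt (m + n) \<bullet> v)"
proof (rule poly_mapping_eqI)
  fix k :: "('a \<times> int) \<times> ('a \<times> int)"
  obtain a i b j where k: "k = ((a, i), (b, j))" by (metis prod.exhaust)
  have idx: "x - of_int (m + n) = x - of_int m - of_int n" "x - of_int n - of_int m = x - of_int m - of_int n"
    for x :: 'a by simp_all
  show "Poly_Mapping.lookup (witt m \<bullet> witt n \<bullet> v - witt n \<bullet> witt m \<bullet> v) k =
      Poly_Mapping.lookup (of_int (n - m) *\<^sub>p (witt (m + n) \<bullet> v)) k"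
    unfolding k lookup_minus lookup_scale_pm lookup_witt_act idx by (simp add: algebra_simps)
qed

lemma lookup_witt_act3:
  fixes v :: "('a::field \<times> int) \<times> ('a \<times> int) \<times> ('a \<times> int) \<Rightarrow>\<^sub>0 'a"
  shows "Poly_Mapping.lookup (act3 loop_virasoro_bracket (witt n) v) ((a, i), (b, j), (c, k)) =
    (a - 2 * of_int n) * Poly_Mapping.lookup v ((a - of_int n, i), (b, j), (c, k)) +
    (b - 2 * of_int n) * Poly_Mapping.lookup v ((a, i), (b - of_int n, j), (c, k)) +
    (c - 2 * of_int n) * Poly_Mapping.lookup v ((a, i), (b, j), (c - of_int n, k))"
proof (induction v rule: basis_induct)
  case (basis p)
  obtain a' i' b' j' c' k' where p: "p = ((a', i'), (b', j'), (c', k'))" by (metis prod.exhaust)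
  have shift: "x + of_int n = y \<longleftrightarrow> x = y - of_int n" "of_int n + x = y \<longleftrightarrow> x = y - of_int n" for x y :: 'a
    by (auto simp: algebra_simps)
  show ?case
    by (simp add: p act3_def witt_def loop_virasoro_bracket_basis tensor_linear del: scale_single)
       (simp add: lookup_add lookup_single when_def shift)
next
  case (add f g)
  then show ?case by (simp add: lookup_add algebra_simps)
next
  case (scale d f)
  then show ?case by (simp add: distrib_left mult.left_commute)
qed simp

lemma ex_int_avoiding:
  fixes S :: "'a::field_char_0 set"
  assumes "finite S"
  obtains n :: int where "of_int n \<notin> S"
proof -
  have "infinite (range (of_int :: int \<Rightarrow> 'a))"
    using finite_imageD[of "of_int :: int \<Rightarrow> 'a" UNIV] infinite_UNIV_int by (auto simp: inj_on_def)
  with assms that show ?thesis by (meson finite_subset image_subsetI)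
qed

text \<open>
  The coefficient of \<open>L\<^sub>n v\<close> at \<open>(a + n, b)\<close> is \<open>(a - n) v(a, b) + (b - 2 n) v(a + n, b - n)\<close>.  For generic \<open>n\<close> the
  second term is outside the finite support of \<open>v\<close> and \<open>a - n\<close> is not zero.
\<close>

lemma lookup_eq_0_of_witt_act:
  fixes v :: "('a::field_char_0 \<times> int) \<times> ('a \<times> int) \<Rightarrow>\<^sub>0 'a"
  assumes inv: "\<And>n. Poly_Mapping.lookup (witt n \<bullet> v) ((a + of_int n, i), (b, j)) = 0"
  shows "Poly_Mapping.lookup v ((a, i), (b, j)) = 0"
proof -
  let ?S = "insert a ((\<lambda>p. fst (fst p) - a) ` Poly_Mapping.keys v)"
  obtain n :: int where n: "of_int n \<notin> ?S" by (rule ex_int_avoiding[of ?S]) auto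
  then have "Poly_Mapping.lookup v ((a + of_int n, i), (b - of_int n, j)) = 0"
    by (force simp: image_iff in_keys_iff)
  then show ?thesis using n inv[of n] by (auto simp: lookup_witt_act)
qed

lemma witt_invariant_eq_0:
  fixes v :: "('a::field_char_0 \<times> int) \<times> ('a \<times> int) \<Rightarrow>\<^sub>0 'a"
  assumes inv: "\<And>n. witt n \<bullet> v = 0"
  shows "v = 0"
proof (rule poly_mapping_eqI)
  fix k :: "('a \<times> int) \<times> ('a \<times> int)"
  obtain a i b j where k: "k = ((a, i), (b, j))" by (metis prod.exhaust)
  have "Poly_Mapping.lookup v ((a, i), (b, j)) = 0"
    by (rule lookup_eq_0_of_witt_act) (simp add: inv)
  then show "Poly_Mapping.lookup v k = Poly_Mapping.lookup 0 k" by (simp add: k)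
qed

lemma witt_invariant3_eq_0:
  fixes v :: "('a::field_char_0 \<times> int) \<times> ('a \<times> int) \<times> ('a \<times> int) \<Rightarrow>\<^sub>0 'a"
  assumes inv: "\<And>n. act3 loop_virasoro_bracket (witt n) v = 0"
  shows "v = 0"
proof (rule poly_mapping_eqI)
  fix p :: "('a \<times> int) \<times> ('a \<times> int) \<times> ('a \<times> int)"
  obtain a i b j c k where p: "p = ((a, i), (b, j), (c, k))" by (metis prod.exhaust)
  let ?S = "insert a ((\<lambda>p. fst (fst p) - a) ` Poly_Mapping.keys v)"
  obtain n :: int where n: "of_int n \<notin> ?S" by (rule ex_int_avoiding[of ?S]) auto
  then have far: "Poly_Mapping.lookup v ((a + of_int n, i), q) = 0" for q
    by (force simp: image_iff in_keys_iff)
  have "Poly_Mapping.lookup (act3 loop_virasoro_bracket (witt n) v) ((a + of_int n, i), (b, j), (c, k)) = 0"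
    by (simp add: inv)
  then show "Poly_Mapping.lookup v p = Poly_Mapping.lookup 0 p"
    using n by (auto simp: lookup_witt_act3 far p)
qed

text \<open>
  If a map from the span of the \<open>L\<^sub>\<beta>\<^sub>+\<^sub>n\<^sub>,\<^sub>i\<close> to \<open>L \<otimes> L\<close> commutes with the Witt algebra, the image \<open>v\<close> of
  \<open>L\<^sub>\<beta>\<^sub>,\<^sub>i\<close> satisfies the hypothesis, for \<open>L\<^sub>-\<^sub>n L\<^sub>n L\<^sub>\<beta>\<^sub>,\<^sub>i = (\<beta> - n) (\<beta> + 2 n) L\<^sub>\<beta>\<^sub>,\<^sub>i\<close>.  Comparing coefficients at
  \<open>(a + n, b - n)\<close> for generic \<open>n\<close>, the right-hand side contributes nothing, and the left-hand side only
  \<open>(a - n) (b + n) v(a, b)\<close>.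
\<close>

lemma witt_intertwiner_eq_0:
  fixes v :: "('a::field_char_0 \<times> int) \<times> ('a \<times> int) \<Rightarrow>\<^sub>0 'a"
  assumes tw: "\<And>n. witt (- n) \<bullet> witt n \<bullet> v =
    ((\<beta> - of_int n) * (\<beta> + 2 * of_int n)) *\<^sub>p v"
  shows "v = 0"
proof (rule poly_mapping_eqI)
  fix k :: "('a \<times> int) \<times> ('a \<times> int)"
  obtain a i b j where k: "k = ((a, i), (b, j))" by (metis prod.exhaust)
  let ?S = "{a, - b} \<union> (\<lambda>p. fst (fst p) - a) ` Poly_Mapping.keys v \<union>
    (\<lambda>p. (fst (fst p) - a) / 2) ` Poly_Mapping.keys v"
  obtain n :: int where n: "of_int n \<notin> ?S" by (rule ex_int_avoiding[of ?S]) auto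
  \<comment> \<open>For such \<open>n\<close> the first factors \<open>a + n\<close> and \<open>a + 2 n\<close> lie outside the support of \<open>v\<close>.\<close>
  have far: "Poly_Mapping.lookup v ((a + of_int n, i), q) = 0"
    "Poly_Mapping.lookup v ((a + 2 * of_int n, i), q) = 0" for q
    using n by (force simp: image_iff in_keys_iff)+
  have "Poly_Mapping.lookup (witt (- n) \<bullet> witt n \<bullet> v) ((a + of_int n, i), (b - of_int n, j)) =
      (b + of_int n) * ((a - of_int n) * Poly_Mapping.lookup v ((a, i), (b, j)))"
    using far by (simp add: lookup_witt_act algebra_simps)
  moreover have "b + of_int n \<noteq> 0"
    using n by (auto simp: add_eq_0_iff)
  ultimately show "Poly_Mapping.lookup v k = Poly_Mapping.lookup 0 k"
    using n far by (auto simp: tw k)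
qed

section \<open>Cocycles of the Witt algebra on one integer coset\<close>

lemma finite_support_zero_upto:
  fixes f :: "int \<Rightarrow> 'a::zero"
  assumes fin: "finite {x. f x \<noteq> 0}"
    and step: "\<And>x. x < K \<Longrightarrow> f x = 0 \<Longrightarrow> f (x + 1) = 0"
    and "x \<le> K"
  shows "f x = 0"
proof -
  have "bdd_below {x. f x \<noteq> 0}"
    by (rule bdd_below_finite[OF fin])
  then obtain l where l: "\<And>x. f x \<noteq> 0 \<Longrightarrow> l \<le> x"
    by (auto simp: bdd_below_def)
  have "f (min l x - 1 + int k) = 0" if "min l x - 1 + int k \<le> K" for k
    using that
  proof (induction k)
    case 0
    show ?case using l[of "min l x - 1"] by fastforce
  next
    case (Suc k)
    then show ?case
      using step[of "min l x - 1 + int k"] by (simp add: algebra_simps)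
  qed
  moreover have "min l x - 1 + int (nat (x - (min l x - 1))) = x" by linarith
  ultimately show ?thesis using assms(3) by metis
qed

corollary finite_support_zero:
  fixes f :: "int \<Rightarrow> 'a::zero"
  assumes "finite {x. f x \<noteq> 0}" and "\<And>x. f x = 0 \<Longrightarrow> f (x + 1) = 0"
  shows "f x = 0"
  using finite_support_zero_upto[OF assms(1), of x x] assms(2) by simp

lemma finite_support_zero_from:
  fixes f :: "int \<Rightarrow> 'a::zero"
  assumes fin: "finite {x. f x \<noteq> 0}"
    and step: "\<And>x. x \<ge> K \<Longrightarrow> f (x + 1) = 0 \<Longrightarrow> f x = 0"
    and "x \<ge> K"
  shows "f x = 0"
proof -
  have "{x. f (- x) \<noteq> 0} = uminus ` {x. f x \<noteq> 0}"
    by (auto simp: image_iff) (metis minus_minus)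
  then have "finite {x. f (- x) \<noteq> 0}" using fin by simp
  from finite_support_zero_upto[OF this, of "- K" "- x"] show ?thesis
    using step[of "- _ - 1"] assms(3) by simp
qed

lemma finite_support_induct [consumes 1, case_names zero add single]:
  fixes f :: "int \<Rightarrow> 'a::field"
  assumes fin: "finite {x. f x \<noteq> 0}"
    and zero: "P (\<lambda>_. 0)"
    and add: "\<And>f g. P f \<Longrightarrow> P g \<Longrightarrow> P (\<lambda>x. f x + g x)"
    and single: "\<And>y k. P (\<lambda>x. k when x = y)"
  shows "P f"
proof -
  have "P (\<lambda>x. \<Sum>y\<in>S. f y when x = y)" if "finite S" for S
    using that by (induction S rule: finite_induct) (auto intro: zero add single)
  from this[OF fin] show ?thesis
    by (rule back_subst[of P]) (auto simp: fun_eq_iff when_def sum.delta fin)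
qed

lemma finite_support_add:
  fixes f g :: "int \<Rightarrow> 'a::field"
  shows "finite {x. f x \<noteq> 0} \<Longrightarrow> finite {x. g x \<noteq> 0} \<Longrightarrow> finite {x. f x + g x \<noteq> 0}"
  by (rule finite_subset[of _ "{x. f x \<noteq> 0} \<union> {x. g x \<noteq> 0}"]) auto

text \<open>
  A sequence \<open>f\<close> encodes the tensor \<open>\<Sum>x. f x L\<^sub>c\<^sub>+\<^sub>x \<otimes> L\<^sub>m\<^sub>-\<^sub>c\<^sub>-\<^sub>x\<close> of weight \<open>m\<close>; then \<open>weight_act c n m f\<close> encodes its
  image under \<open>L\<^sub>n\<close>, which has weight \<open>m + n\<close>.
\<close>

definition weight_act :: "'a::field \<Rightarrow> int \<Rightarrow> int \<Rightarrow> (int \<Rightarrow> 'a) \<Rightarrow> int \<Rightarrow> 'a"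
  where "weight_act c n m f x =
    (c + of_int (x - 2 * n)) * f (x - n) + (of_int (m - x - n) - c) * f x"

text \<open>
  The sequence \<open>d n\<close> encodes the value at \<open>L\<^sub>n\<close>, of weight \<open>n\<close>, of a derivation of the Witt algebra.
\<close>

definition weight_cocycle :: "'a::field \<Rightarrow> (int \<Rightarrow> int \<Rightarrow> 'a) \<Rightarrow> bool"
  where "weight_cocycle c d \<longleftrightarrow> (\<forall>m n x.
    of_int (n - m) * d (m + n) x = weight_act c m n (d n) x - weight_act c n m (d m) x)"

lemma weight_act_add:
    "weight_act c n m (\<lambda>x. f x + g x) x = weight_act c n m f x + weight_act c n m g x"
  and weight_act_scale: "weight_act c n m (\<lambda>x. k * f x) x = k * weight_act c n m f x"
  by (simp_all add: weight_act_def algebra_simps)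

lemma finite_support_weight_act:
  assumes "finite {x. f x \<noteq> 0}"
  shows "finite {x. weight_act c n m f x \<noteq> 0}"
proof (rule finite_subset)
  show "{x. weight_act c n m f x \<noteq> 0} \<subseteq> {x. f x \<noteq> 0} \<union> (\<lambda>x. x + n) ` {x. f x \<noteq> 0}"
    by (auto simp: weight_act_def image_iff) (metis diff_add_cancel)
qed (use assms in simp)

lemma weight_cocycleD:
  "weight_cocycle c d \<Longrightarrow>
    of_int (n - m) * d (m + n) x = weight_act c m n (d n) x - weight_act c n m (d m) x"
  by (simp add: weight_cocycle_def)

lemma weight_cocycle_diff_coboundary:
  assumes "weight_cocycle c d"
  shows "weight_cocycle c (\<lambda>n x. d n x - weight_act c n 0 r x)"
  unfolding weight_cocycle_def
proof (intro allI)
  fix m n x :: int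
  have idx: "x - m - n = x - (m + n)" "x - n - m = x - (m + n)" for m n x :: int by simp_all
  show "of_int (n - m) * (d (m + n) x - weight_act c (m + n) 0 r x) =
      weight_act c m n (\<lambda>x. d n x - weight_act c n 0 r x) x -
      weight_act c n m (\<lambda>x. d m x - weight_act c m 0 r x) x"
    using weight_cocycleD[OF assms, where m = m and n = n and x = x]
    unfolding weight_act_def idx by (simp add: algebra_simps)
qed

text \<open>
  The elements \<open>L\<^sub>1, L\<^sub>-\<^sub>1, L\<^sub>2, L\<^sub>-\<^sub>2\<close> generate the Witt algebra.
\<close>

lemma weight_cocycle_eq_0:
  fixes c :: "'a::field_char_0"
  assumes co: "weight_cocycle c d"
    and gen: "\<And>x. d 1 x = 0" "\<And>x. d (- 1) x = 0" "\<And>x. d 2 x = 0" "\<And>x. d (- 2) x = 0"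
  shows "d n x = 0"
proof -
  have pos: "d (int k + 2) x = 0" for k x
  proof (induction k arbitrary: x)
    case (Suc k)
    have "of_int (int k + 2 - 1) * d (1 + (int k + 2)) x = 0"
      using weight_cocycleD[OF co, where m = 1 and n = "int k + 2"] Suc.IH gen
      by (simp add: weight_act_def)
    moreover have "(of_int (int k + 2 - 1) :: 'a) \<noteq> 0" unfolding of_int_eq_0_iff by simp
    ultimately show ?case by (simp add: add.commute add.left_commute)
  qed (use gen in simp)
  have neg: "d (- int k - 2) x = 0" for k x
  proof (induction k arbitrary: x)
    case (Suc k)
    have "of_int (- int k - 2 - (- 1)) * d (- 1 + (- int k - 2)) x = 0"
      using weight_cocycleD[OF co, where m = "- 1" and n = "- int k - 2"] Suc.IH gen
      by (simp add: weight_act_def)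
    moreover have "(of_int (- int k - 2 - (- 1)) :: 'a) \<noteq> 0" unfolding of_int_eq_0_iff by simp
    moreover have "- 1 + (- int k - 2) = - int (Suc k) - 2" by simp
    ultimately show ?case by (metis mult_eq_0_iff)
  qed (use gen in simp)
  have "of_int (1 - - 1) * d (- 1 + 1) x = 0"
    using weight_cocycleD[OF co, where m = "- 1" and n = 1] gen by (simp add: weight_act_def)
  then have zero: "d 0 x = 0" by simp
  consider "n = 0" | "n = 1" | "n = - 1" | "n = int (nat (n - 2)) + 2" | "n = - int (nat (- n - 2)) - 2"
    by linarith
  then show ?thesis
    using zero gen pos[of "nat (n - 2)"] neg[of "nat (- n - 2)"] by cases metis+
qed

text \<open>
  Congruence of a sequence of weight 1, modulo the image of \<open>L\<^sub>1\<close>, to a sequence supported on \<open>T\<close>.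
\<close>

definition reducible_to :: "'a::field \<Rightarrow> int set \<Rightarrow> (int \<Rightarrow> 'a) \<Rightarrow> bool"
  where "reducible_to c T f \<longleftrightarrow>
    (\<exists>r. finite {x. r x \<noteq> 0} \<and> (\<forall>x. x \<notin> T \<longrightarrow> f x = weight_act c 1 0 r x))"

lemma reducible_to_zero: "reducible_to c T (\<lambda>_. 0)"
  unfolding reducible_to_def by (rule exI[of _ "\<lambda>_. 0"]) (simp add: weight_act_def)

lemma reducible_to_add:
  assumes "reducible_to c T f" "reducible_to c T g"
  shows "reducible_to c T (\<lambda>x. f x + g x)"
proof -
  obtain r s where rs: "finite {x. r x \<noteq> 0}" "\<forall>x. x \<notin> T \<longrightarrow> f x = weight_act c 1 0 r x"
    "finite {x. s x \<noteq> 0}" "\<forall>x. x \<notin> T \<longrightarrow> g x = weight_act c 1 0 s x"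
    using assms unfolding reducible_to_def by blast
  then show ?thesis
    unfolding reducible_to_def
    by (intro exI[of _ "\<lambda>x. r x + s x"]) (simp add: finite_support_add weight_act_add)
qed

lemma reducible_to_scale:
  assumes "reducible_to c T f"
  shows "reducible_to c T (\<lambda>x. k * f x)"
proof -
  obtain r where r: "finite {x. r x \<noteq> 0}" "\<forall>x. x \<notin> T \<longrightarrow> f x = weight_act c 1 0 r x"
    using assms unfolding reducible_to_def by blast
  have "finite {x. k * r x \<noteq> 0}" by (rule finite_subset[OF _ r(1)]) auto
  with r show ?thesis
    unfolding reducible_to_def
    by (intro exI[of _ "\<lambda>x. k * r x"]) (simp add: weight_act_scale)
qed

lemma reducible_to_single: "y \<in> T \<Longrightarrow> reducible_to c T (\<lambda>x. k when x = y)"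
  unfolding reducible_to_def
  by (rule exI[of _ "\<lambda>_. 0"]) (auto simp: weight_act_def when_def)

lemma reducible_to_coboundary:
  "finite {x. r x \<noteq> 0} \<Longrightarrow> reducible_to c T (weight_act c 1 0 r)"
  unfolding reducible_to_def by blast

text \<open>
  Since \<open>L\<^sub>1\<close> maps the basis tensor at \<open>y\<close> to a combination of those at \<open>y\<close> and \<open>y + 1\<close>, either of them can be
  traded for the other unless its coefficient vanishes.
\<close>

lemma reducible_to_step:
  fixes c :: "'a::field"
  shows "c + of_int (y - 1) \<noteq> 0 \<Longrightarrow> reducible_to c T (\<lambda>x. 1 when x = y) \<Longrightarrow>
      reducible_to c T (\<lambda>x. 1 when x = y + 1)" (is "?A \<Longrightarrow> ?P y \<Longrightarrow> ?P (y + 1)")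
    and "c + of_int (y + 1) \<noteq> 0 \<Longrightarrow> reducible_to c T (\<lambda>x. 1 when x = y + 1) \<Longrightarrow>
      reducible_to c T (\<lambda>x. 1 when x = y)" (is "?B \<Longrightarrow> _ \<Longrightarrow> _")
proof -
  let ?e = "\<lambda>y x. 1 when x = y :: 'a"
  have "finite {x. ?e y x \<noteq> 0}" by (rule finite_subset[of _ "{y}"]) (auto simp: when_def)
  then have im: "reducible_to c T (weight_act c 1 0 (?e y))" by (rule reducible_to_coboundary)
  have eq: "weight_act c 1 0 (?e y) x =
      (c + of_int (y - 1)) * ?e (y + 1) x - (c + of_int (y + 1)) * ?e y x" for x
    by (auto simp: weight_act_def when_def algebra_simps)
  show "?P (y + 1)" if nz: ?A and "?P y"
  proof -
    have "?e (y + 1) = (\<lambda>x. 1 / (c + of_int (y - 1)) *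
        (weight_act c 1 0 (?e y) x + (c + of_int (y + 1)) * ?e y x))"
      using nz by (simp add: eq fun_eq_iff del: of_int_add of_int_diff)
    then show ?thesis
      by (rule ssubst) (intro reducible_to_scale reducible_to_add im \<open>?P y\<close>)
  qed
  show "?P y" if nz: ?B and "?P (y + 1)"
  proof -
    have "?e y = (\<lambda>x. - 1 / (c + of_int (y + 1)) *
        (weight_act c 1 0 (?e y) x + (- (c + of_int (y - 1))) * ?e (y + 1) x))"
      using nz by (simp add: eq fun_eq_iff field_simps del: of_int_add of_int_diff)
    then show ?thesis
      by (rule ssubst) (intro reducible_to_scale reducible_to_add im \<open>?P (y + 1)\<close>)
  qed
qed

lemma reducible_toI:
  assumes "\<And>y. reducible_to c T (\<lambda>x. 1 when x = y)" and "finite {x. f x \<noteq> 0}"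
  shows "reducible_to c T f"
  using assms(2)
proof (induction f rule: finite_support_induct)
  case (single y k)
  show ?case using reducible_to_scale[OF assms(1), of k y] by (simp add: when_def if_distrib cong: if_cong)
qed (simp_all add: reducible_to_zero reducible_to_add)

lemma reducible_generic:
  fixes c :: "'a::field_char_0"
  assumes "c \<notin> \<int>" "finite {x. f x \<noteq> 0}"
  shows "reducible_to c {0} f"
proof (rule reducible_toI[OF _ assms(2)])
  have nz: "c + of_int k \<noteq> 0" for k
    using assms(1) by (metis Ints_minus Ints_of_int add_eq_0_iff minus_minus)
  show "reducible_to c {0} (\<lambda>x. 1 when x = y)" for y
  proof (induction y rule: int_induct[of _ 0])
    case (step2 i)
    then show ?case using reducible_to_step(2)[of c "i - 1" "{0}"] nz by simp
  qed (simp_all add: reducible_to_single reducible_to_step(1) nz del: of_int_diff)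
qed

text \<open>
  On the coset of \<open>0\<close> a coefficient of \<open>L\<^sub>1\<close> vanishes at \<open>y = - 1\<close> and at \<open>y = 1\<close>.  This cuts the integers
  into \<open>y \<le> - 1\<close> and \<open>y \<ge> 2\<close>, each of which retains one point, and \<open>0, 1\<close>, which are reached from \<open>- 1\<close>.
\<close>

lemma reducible_integral:
  fixes f :: "int \<Rightarrow> 'a::field_char_0"
  assumes "finite {x. f x \<noteq> 0}"
  shows "reducible_to 0 {- 1, 2} f"
proof (rule reducible_toI[OF _ assms])
  let ?P = "\<lambda>y. reducible_to (0::'a) {- 1, 2} (\<lambda>x. 1 when x = y)"
  have up: "?P (y + 1)" if "?P y" "y \<noteq> 1" for y
    by (rule reducible_to_step(1)[OF _ that(1)]) (use that(2) in \<open>unfold add_0_left of_int_eq_0_iff, simp\<close>)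
  have down: "?P (y - 1)" if "?P y" "y \<noteq> 0" for y
    using reducible_to_step(2)[of "0::'a" "y - 1" "{- 1, 2}"] that by simp
  have base: "?P (- 1)" "?P 2" by (simp_all add: reducible_to_single)
  have zero: "?P 0" using up[of "- 1"] base by simp
  have one: "?P 1" using up[of 0] zero by simp
  have high: "?P y" if "y \<ge> 2" for y
    using that by (induction y rule: int_ge_induct) (use base up in auto)
  have low: "?P y" if "y \<le> - 1" for y
    using that by (induction y rule: int_le_induct) (use base down in auto)
  show "?P y" for y
  proof -
    consider "y = 0" | "y = 1" | "y \<ge> 2" | "y \<le> - 1" by linarith
    then show ?thesis using zero one high low by cases simp_all
  qed
qed

text \<open>
  The coefficients of the recursions that the relations impose have the form \<open>\<plusminus>(c + k)\<close> with \<open>k\<close> an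
  integer, so they are not zero, and a nonzero sequence can begin or stop only where the right-hand
  side does not vanish.
\<close>

lemma generic_normalised_cocycle_eq_0:
  fixes c :: "'a::field_char_0"
  assumes co: "weight_cocycle c d" and zero: "\<And>x. d 0 x = 0"
    and fin: "\<And>n. finite {x. d n x \<noteq> 0}"
    and c: "c \<notin> \<int>" and supp: "\<And>x. x \<noteq> 0 \<Longrightarrow> d 1 x = 0"
  shows "d n x = 0"
proof -
  have nz: "c + of_int k \<noteq> 0" for k
    using c by (metis Ints_minus Ints_of_int add_eq_0_iff minus_minus)
  have nz': "of_int k - c \<noteq> 0" for k
    using c by (metis Ints_of_int eq_iff_diff_eq_0)
  \<comment> \<open>\<open>[L\<^sub>-\<^sub>1, L\<^sub>1] = 2 L\<^sub>0\<close> and \<open>d 0 = 0\<close> couple \<open>d 1\<close> and \<open>d (- 1)\<close> only through \<open>u\<close>.\<close>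
  define u where "u x = d 1 (x + 1) + d (- 1) x" for x
  have ufin: "finite {x. u x \<noteq> 0}"
    unfolding u_def
    by (rule finite_support_add[OF finite_surj[OF fin[of 1], of _ "\<lambda>x. x - 1"] fin])
       (auto simp: image_iff intro!: exI[of _ "_ + 1"])
  have urec: "(c + of_int (x + 2)) * u x = (c + of_int (x - 2)) * u (x - 1)" for x
    using weight_cocycleD[OF co, where m = "- 1" and n = 1 and x = x] zero
    by (simp add: weight_act_def u_def algebra_simps)
  have "u x = 0" for x
  proof (rule finite_support_zero[OF ufin])
    show "u (x + 1) = 0" if "u x = 0" for x
      using urec[of "x + 1"] that nz[of "x + 1 + 2"] by (simp del: of_int_add)
  qed
  then have dm1: "d (- 1) x = - d 1 (x + 1)" for x
    using u_def[of x] by (simp add: add_eq_0_iff)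
  define l where "l = d 1 0"
  have d1: "d 1 x = (if x = 0 then l else 0)" for x using supp by (simp add: l_def)
  have dm1': "d (- 1) x = (if x = - 1 then - l else 0)" for x by (auto simp: dm1 d1)
  \<comment> \<open>The relation \<open>[L\<^sub>-\<^sub>1, L\<^sub>2] = 3 L\<^sub>1\<close>.\<close>
  have d2: "(c + of_int (x + 2)) * d 2 (x + 1) + (of_int (3 - x) - c) * d 2 x =
      3 * d 1 x + (c + of_int (x - 4)) * d (- 1) (x - 2) - (c + of_int (x + 3)) * d (- 1) x" for x
    using weight_cocycleD[OF co, where m = "- 1" and n = 2 and x = x]
    by (simp add: weight_act_def algebra_simps)
  have left: "d 2 x = 0" if "x \<le> - 1" for x
  proof (rule finite_support_zero_upto[OF fin _ that])
    show "d 2 (x + 1) = 0" if "x < - 1" "d 2 x = 0" for x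
      using d2[of x] that nz[of "x + 2"] by (simp add: d1 dm1' del: of_int_add)
  qed
  have right: "d 2 x = 0" if "x \<ge> 2" for x
  proof (rule finite_support_zero_from[OF fin _ that])
    show "d 2 x = 0" if "x \<ge> 2" "d 2 (x + 1) = 0" for x
      using d2[of x] that nz'[of "3 - x"] by (simp add: d1 dm1' del: of_int_diff)
  qed
  \<comment> \<open>Three equations for the two unknowns \<open>d 2 0\<close> and \<open>d 2 1\<close>: eliminating them leaves \<open>12 l = 0\<close>.\<close>
  have e: "(c + 1) * d 2 0 = (c + 2) * l" "(c + 2) * d 2 1 + (3 - c) * d 2 0 = 3 * l"
    "(2 - c) * d 2 1 = - (c - 3) * l"
    using d2[of "- 1"] d2[of 0] d2[of 1] left[of "- 1"] right[of 2]
    by (simp_all add: d1 dm1' algebra_simps)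
  have "(c + 1) * ((c + 2) * d 2 1) + (3 - c) * ((c + 1) * d 2 0) = (c + 1) * (3 * l)"
    unfolding e(2)[symmetric] by (simp add: algebra_simps)
  then have "(c + 1) * ((c + 2) * d 2 1) = (c + 1) * (3 * l) - (3 - c) * ((c + 2) * l)"
    unfolding e(1) by (simp add: algebra_simps)
  then have "(2 - c) * ((c + 1) * (3 * l) - (3 - c) * ((c + 2) * l)) = (c + 1) * (c + 2) * ((2 - c) * d 2 1)"
    by (metis (no_types, opaque_lifting) mult.assoc mult.commute)
  then have "12 * l = 0"
    unfolding e(3) by (simp add: algebra_simps)
  then have "l = 0" by simp
  then have one: "d 1 x = 0" "d (- 1) x = 0" for x by (simp_all add: d1 dm1')
  have two: "d 2 x = 0" for x
  proof (rule finite_support_zero[OF fin])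
    show "d 2 (x + 1) = 0" if "d 2 x = 0" for x
      using d2[of x] that nz[of "x + 2"] by (simp add: one del: of_int_add)
  qed
  \<comment> \<open>The relation \<open>[L\<^sub>1, L\<^sub>-\<^sub>2] = - 3 L\<^sub>-\<^sub>1\<close>.\<close>
  have m2: "(c + of_int (x - 2)) * d (- 2) (x - 1) = (c + of_int (x + 3)) * d (- 2) x" for x
    using weight_cocycleD[OF co, where m = 1 and n = "- 2" and x = x] one
    by (simp add: weight_act_def algebra_simps)
  have mtwo: "d (- 2) x = 0" for x
  proof (rule finite_support_zero[OF fin])
    show "d (- 2) (x + 1) = 0" if "d (- 2) x = 0" for x
      using m2[of "x + 1"] that nz[of "x + 1 + 3"] by (simp del: of_int_add)
  qed
  show ?thesis by (rule weight_cocycle_eq_0[OF co]) (simp_all add: one two mtwo)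
qed

text \<open>
  On the coset of \<open>0\<close> the recursions do have vanishing coefficients; finiteness of supports is exploited
  from both ends up to those places, and the equations there determine the remaining parameters.
\<close>

lemma integral_normalised_cocycle_vanishes:
  fixes d :: "int \<Rightarrow> int \<Rightarrow> 'a::field_char_0"
  assumes co: "weight_cocycle 0 d" and zero: "\<And>x. d 0 x = 0"
    and fin: "\<And>n. finite {x. d n x \<noteq> 0}"
    and supp: "\<And>x. x \<noteq> - 1 \<Longrightarrow> x \<noteq> 2 \<Longrightarrow> d 1 x = 0"
  shows "d 1 x = 0" "d (- 1) x = 0"
proof -
  define l where "l = d 1 (- 1)"
  define k where "k = d 1 2"
  have d1: "d 1 x = (if x = - 1 then l else if x = 2 then k else 0)" for x
    using supp by (simp add: l_def k_def)
  define u where "u x = d 1 (x + 1) + d (- 1) x" for x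
  have ufin: "finite {x. u x \<noteq> 0}"
    unfolding u_def
    by (rule finite_support_add[OF finite_surj[OF fin[of 1], of _ "\<lambda>x. x - 1"] fin])
       (auto simp: image_iff intro!: exI[of _ "_ + 1"])
  have urec: "of_int (x + 2) * u x = of_int (x - 2) * u (x - 1)" for x
    using weight_cocycleD[OF co, where m = "- 1" and n = 1 and x = x] zero
    by (simp add: weight_act_def u_def algebra_simps)
  have uleft: "u x = 0" if "x \<le> - 3" for x
  proof (rule finite_support_zero_upto[OF ufin _ that])
    show "u (x + 1) = 0" if "x < - 3" "u x = 0" for x
      using urec[of "x + 1"] that by (simp add: of_int_eq_0_iff del: of_int_add)
  qed
  have uright: "u x = 0" if "x \<ge> 2" for x
  proof (rule finite_support_zero_from[OF ufin _ that])
    show "u x = 0" if "x \<ge> 2" "u (x + 1) = 0" for x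
      using urec[of "x + 1"] that by (simp add: of_int_eq_0_iff del: of_int_diff)
  qed
  \<comment> \<open>The finitely supported solutions of \<open>urec\<close> are the multiples of \<open>(1, -3, 3, -1)\<close> on \<open>- 2, ..., 1\<close>.\<close>
  define v where "v = u (- 2)"
  have uval: "u (- 1) = - 3 * v" "u 0 = 3 * v" "u 1 = - v"
    using urec[of "- 1"] urec[of 0] urec[of 1] by (simp_all add: v_def)
  have dm1: "d (- 1) x = u x - d 1 (x + 1)" for x by (simp add: u_def)
  \<comment> \<open>The relation \<open>[L\<^sub>-\<^sub>1, L\<^sub>2] = 3 L\<^sub>1\<close>; one coefficient on the left vanishes at \<open>x = - 2\<close>, the other one
    at \<open>x = 3\<close>, and since \<open>d 2\<close> is 0 beyond these points they yield \<open>v = l\<close> and \<open>k = - l\<close>.\<close>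
  have d2: "of_int (x + 2) * d 2 (x + 1) + of_int (3 - x) * d 2 x =
      3 * d 1 x + of_int (x - 4) * d (- 1) (x - 2) - of_int (x + 3) * d (- 1) x" for x
    using weight_cocycleD[OF co, where m = "- 1" and n = 2 and x = x]
    by (simp add: weight_act_def algebra_simps)
  have "d 2 x = 0" if "x \<le> - 2" for x
  proof (rule finite_support_zero_upto[OF fin _ that])
    show "d 2 (x + 1) = 0" if "x < - 2" "d 2 x = 0" for x
      using d2[of x] that by (simp add: d1 dm1 uleft of_int_eq_0_iff del: of_int_add)
  qed
  then have "v = l" using d2[of "- 2"] by (simp add: d1 dm1 uleft v_def)
  have "d 2 x = 0" if "x \<ge> 4" for x
  proof (rule finite_support_zero_from[OF fin _ that])
    show "d 2 x = 0" if "x \<ge> 4" "d 2 (x + 1) = 0" for x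
      using d2[of x] that by (simp add: d1 dm1 uright of_int_eq_0_iff del: of_int_diff)
  qed
  then have "k = - l" using d2[of 3] uval \<open>v = l\<close> by (simp add: d1 dm1 uright eq_neg_iff_add_eq_0)
  \<comment> \<open>The relation \<open>[L\<^sub>1, L\<^sub>-\<^sub>2] = - 3 L\<^sub>-\<^sub>1\<close>; the coefficient of \<open>d (- 2) x\<close> vanishes at \<open>x = - 3\<close>, which forces \<open>l = 0\<close>.\<close>
  have m2: "of_int (x - 2) * d (- 2) (x - 1) - of_int (x + 3) * d (- 2) x =
      - 3 * d (- 1) x + of_int (x + 4) * d 1 (x + 2) + of_int (3 - x) * d 1 x" for x
    using weight_cocycleD[OF co, where m = 1 and n = "- 2" and x = x]
    by (simp add: weight_act_def algebra_simps)
  have dm1_left: "d (- 1) x = 0" if "x \<le> - 2" for x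
    using that uleft[of x] \<open>v = l\<close> by (cases "x = - 2") (auto simp: d1 dm1 v_def)
  have "d (- 2) x = 0" if "x \<le> - 4" for x
  proof (rule finite_support_zero_upto[OF fin _ that])
    show "d (- 2) (x + 1) = 0" if "x < - 4" "d (- 2) x = 0" for x
      using m2[of "x + 1"] that by (simp add: d1 dm1_left of_int_eq_0_iff del: of_int_add)
  qed
  then have "l = 0" using m2[of "- 3"] dm1_left[of "- 3"] by (simp add: d1)
  then show "d 1 x = 0" using \<open>k = - l\<close> by (simp add: d1)
  have "u x = 0"
    using uval uleft[of x] uright[of x] \<open>v = l\<close> \<open>l = 0\<close> v_def
    by (cases "x \<le> - 3 \<or> x \<ge> 2 \<or> x = -2 \<or> x = -1 \<or> x = 0 \<or> x = 1") auto
  then show "d (- 1) x = 0" using \<open>k = - l\<close> \<open>l = 0\<close> by (simp add: d1 dm1)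
qed

text \<open>
  A cocycle that vanishes at \<open>L\<^sub>1\<close> and \<open>L\<^sub>-\<^sub>1\<close> need not vanish at \<open>L\<^sub>2\<close>: its value there is annihilated by
  \<open>L\<^sub>-\<^sub>1\<close>, hence a multiple of \<open>(1, -4, 6, -4, 1)\<close> on \<open>- 1, ..., 3\<close>.
\<close>

lemma integral_cocycle_coboundary_of_normalised:
  fixes d :: "int \<Rightarrow> int \<Rightarrow> 'a::field_char_0"
  assumes co: "weight_cocycle 0 d" and zero: "\<And>x. d 0 x = 0"
    and fin: "\<And>n. finite {x. d n x \<noteq> 0}"
    and one: "\<And>x. d 1 x = 0" and mone: "\<And>x. d (- 1) x = 0"
  obtains r where "finite {x. r x \<noteq> 0}" "\<And>n x. d n x = weight_act 0 n 0 r x"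
proof -
  define s where "s = d 2 (- 1)"
  \<comment> \<open>\<open>r\<close> is a multiple of the Casimir tensor of \<open>L\<^sub>-\<^sub>1, L\<^sub>0, L\<^sub>1\<close>, which \<open>L\<^sub>1\<close> and \<open>L\<^sub>-\<^sub>1\<close> annihilate but \<open>L\<^sub>2\<close> does not.\<close>
  define r where "r x = (if x = - 1 \<or> x = 1 then - s else if x = 0 then 2 * s else 0)" for x :: int
  have r: "finite {x. r x \<noteq> 0}"
    by (rule finite_subset[of _ "{- 1, 0, 1}"]) (auto simp: r_def)
  define e where "e n x = d n x - weight_act 0 n 0 r x" for n x
  have eco: "weight_cocycle 0 e"
    unfolding e_def by (rule weight_cocycle_diff_coboundary[OF co])
  have efin: "finite {x. e n x \<noteq> 0}" for n
    unfolding e_def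
    by (rule finite_subset[OF _ finite_UnI[OF fin[of n] finite_support_weight_act[OF r]]]) auto
  have d2: "of_int (x + 2) * d 2 (x + 1) + of_int (3 - x) * d 2 x = 0" for x
    using weight_cocycleD[OF co, where m = "- 1" and n = 2 and x = x] one mone
    by (simp add: weight_act_def algebra_simps)
  have left: "d 2 x = 0" if "x \<le> - 2" for x
  proof (rule finite_support_zero_upto[OF fin _ that])
    show "d 2 (x + 1) = 0" if "x < - 2" "d 2 x = 0" for x
      using d2[of x] that by (simp add: of_int_eq_0_iff del: of_int_add)
  qed
  have right: "d 2 x = 0" if "x \<ge> 4" for x
  proof (rule finite_support_zero_from[OF fin _ that])
    show "d 2 x = 0" if "x \<ge> 4" "d 2 (x + 1) = 0" for x
      using d2[of x] that by (simp add: of_int_eq_0_iff del: of_int_diff)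
  qed
  have d2val: "d 2 0 = - 4 * s" "d 2 1 = 6 * s" "d 2 2 = - 4 * s" "d 2 3 = s"
    using d2[of "- 1"] d2[of 0] d2[of 1] d2[of 2] by (simp_all add: s_def add_eq_0_iff)
  have e0: "e 0 x = 0" for x by (simp add: e_def zero weight_act_def algebra_simps)
  have e1: "e 1 x = 0" for x
    by (auto simp: e_def one weight_act_def r_def algebra_simps)
  have em1: "e (- 1) x = 0" for x
    by (cases "x = - 2") (auto simp: e_def mone weight_act_def r_def algebra_simps)
  have e2: "e 2 x = 0" for x
  proof -
    consider "x \<le> - 2" | "x = - 1" | "x = 0" | "x = 1" | "x = 2" | "x = 3" | "x \<ge> 4" by linarith
    then show ?thesis
      by cases (simp_all add: e_def weight_act_def r_def d2val left right s_def[symmetric] algebra_simps)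
  qed
  have m2: "of_int (x - 2) * e (- 2) (x - 1) = of_int (x + 3) * e (- 2) x" for x
    using weight_cocycleD[OF eco, where m = 1 and n = "- 2" and x = x] e1 em1
    by (simp add: weight_act_def algebra_simps)
  have far: "e (- 2) x = 0" if "x \<le> - 4" for x
  proof (rule finite_support_zero_upto[OF efin _ that])
    show "e (- 2) (x + 1) = 0" if "x < - 4" "e (- 2) x = 0" for x
      using m2[of "x + 1"] that by (simp add: of_int_eq_0_iff del: of_int_add)
  qed
  \<comment> \<open>Coming from the left, the recursion \<open>m2\<close> stops short of \<open>- 3\<close>; the relation between \<open>L\<^sub>2\<close> and \<open>L\<^sub>-\<^sub>2\<close> reaches it.\<close>
  have "of_int (- 3 - 4) * e (- 2) (- 5) = of_int (- 3 + 4) * e (- 2) (- 3)"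
    using weight_cocycleD[OF eco, where m = 2 and n = "- 2" and x = "- 3"] e0 e2
    by (simp add: weight_act_def)
  then have m3: "e (- 2) (- 3) = 0" using far[of "- 5"] by simp
  have em2: "e (- 2) x = 0" for x
  proof (rule finite_support_zero[OF efin])
    show "e (- 2) (x + 1) = 0" if "e (- 2) x = 0" for x
      using m2[of "x + 1"] that m3
      by (cases "x = - 4") (simp_all add: of_int_eq_0_iff del: of_int_add)
  qed
  have "e n x = 0" for n x
    by (rule weight_cocycle_eq_0[OF eco]) (simp_all add: e1 em1 e2 em2)
  then show ?thesis using that[OF r] by (simp add: e_def)
qed

lemma weight_cocycle_normalise:
  assumes co: "weight_cocycle c d" and zero: "\<And>x. d 0 x = 0"
    and fin: "\<And>n. finite {x. d n x \<noteq> 0}" and red: "reducible_to c T (d 1)"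
  obtains r e where "finite {x. r x \<noteq> 0}" "weight_cocycle c e" "\<And>x. e 0 x = 0"
    "\<And>n. finite {x. e n x \<noteq> 0}" "\<And>x. x \<notin> T \<Longrightarrow> e 1 x = 0"
    "\<And>n x. d n x = e n x + weight_act c n 0 r x"
proof -
  obtain r where r: "finite {x. r x \<noteq> 0}" "\<And>x. x \<notin> T \<Longrightarrow> d 1 x = weight_act c 1 0 r x"
    using red unfolding reducible_to_def by blast
  show ?thesis
  proof (rule that[of r "\<lambda>n x. d n x - weight_act c n 0 r x"])
    show "finite {x. d n x - weight_act c n 0 r x \<noteq> 0}" for n
      by (rule finite_subset[OF _ finite_UnI[OF fin[of n] finite_support_weight_act[OF r(1)]]]) auto
    show "d 0 x - weight_act c 0 0 r x = 0" for x
      by (simp add: zero weight_act_def algebra_simps)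
  qed (simp_all add: r weight_cocycle_diff_coboundary[OF co])
qed

lemma weight_cocycle_shift:
  assumes "weight_cocycle (of_int k) d"
  shows "weight_cocycle 0 (\<lambda>n x. d n (x - k))"
  unfolding weight_cocycle_def
proof (intro allI)
  fix m n x
  show "of_int (n - m) * d (m + n) (x - k) =
      weight_act 0 m n (\<lambda>x. d n (x - k)) x - weight_act 0 n m (\<lambda>x. d m (x - k)) x"
    using weight_cocycleD[OF assms, where m = m and n = n and x = "x - k"]
    by (simp add: weight_act_def algebra_simps)
qed

lemma weight_cocycle_coboundary:
  fixes c :: "'a::field_char_0"
  assumes co: "weight_cocycle c d" and zero: "\<And>x. d 0 x = 0"
    and fin: "\<And>n. finite {x. d n x \<noteq> 0}"
  obtains r where "finite {x. r x \<noteq> 0}" "\<And>n x. d n x = weight_act c n 0 r x"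
proof (cases "c \<in> \<int>")
  case False
  obtain r e where r: "finite {x. r x \<noteq> 0}" "weight_cocycle c e" "\<And>x. e 0 x = 0"
    "\<And>n. finite {x. e n x \<noteq> 0}" "\<And>x. x \<notin> {0} \<Longrightarrow> e 1 x = 0"
    "\<And>n x. d n x = e n x + weight_act c n 0 r x"
    by (rule weight_cocycle_normalise[OF co zero fin reducible_generic[OF False fin]]) blast
  have "e n x = 0" for n x
    by (rule generic_normalised_cocycle_eq_0[OF r(2-4) False]) (use r(5) in auto)
  with r(1,6) that show ?thesis by simp
next
  case True
  then obtain k where k: "c = of_int k" by (auto simp: Ints_def)
  define d' where "d' n x = d n (x - k)" for n x
  have co': "weight_cocycle 0 d'"
    unfolding d'_def using weight_cocycle_shift co k by metis
  have fin': "finite {x. d' n x \<noteq> 0}" for n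
    by (rule finite_surj[OF fin[of n], of _ "\<lambda>x. x + k"])
       (auto simp: d'_def image_iff intro!: exI[of _ "_ - k"])
  have zero': "d' 0 x = 0" for x by (simp add: d'_def zero)
  obtain r e where r: "finite {x. r x \<noteq> 0}" and e: "weight_cocycle 0 e" "\<And>x. e 0 x = 0"
    "\<And>n. finite {x. e n x \<noteq> 0}" and e1: "\<And>x. x \<notin> {- 1, 2} \<Longrightarrow> e 1 x = 0"
    and d': "\<And>n x. d' n x = e n x + weight_act 0 n 0 r x"
    by (rule weight_cocycle_normalise[OF co' zero' fin' reducible_integral[OF fin']]) blast
  have "e 1 x = 0" "e (- 1) x = 0" for x
    using integral_normalised_cocycle_vanishes[OF e, of x] e1 by simp_all
  from integral_cocycle_coboundary_of_normalised[OF e this]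
  obtain s where s: "finite {x. s x \<noteq> 0}" "\<And>n x. e n x = weight_act 0 n 0 s x" by blast
  define t where "t x = s (x + k) + r (x + k)" for x
  have "finite {x. t x \<noteq> 0}"
    by (rule finite_surj[OF finite_support_add[OF s(1) r], of _ "\<lambda>x. x - k"])
       (auto simp: t_def image_iff intro!: exI[of _ "_ + k"])
  moreover have "d n x = weight_act c n 0 t x" for n x
  proof -
    have "d n x = d' n (x + k)" by (simp add: d'_def)
    also have "\<dots> = weight_act c n 0 t x"
      by (simp add: d' s(2) t_def weight_act_def k algebra_simps)
    finally show ?thesis .
  qed
  ultimately show ?thesis using that by blast
qed

section \<open>Derivations of the Witt algebra into tensors are inner\<close>

definition witt_cocycle :: "(int \<Rightarrow> (('a::field \<times> int) \<times> ('a \<times> int) \<Rightarrow>\<^sub>0 'a)) \<Rightarrow> bool"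
  where "witt_cocycle D \<longleftrightarrow>
    (\<forall>m n. of_int (n - m) *\<^sub>p D (m + n) = witt m \<bullet> D n - witt n \<bullet> D m)"

lemma witt_cocycle_diff_coboundary:
  assumes "witt_cocycle D"
  shows "witt_cocycle (\<lambda>n. D n - witt n \<bullet> r)"
  using assms unfolding witt_cocycle_def
  by (simp add: diag_action_diff pm.scale_right_diff_distrib witt_act_commutator[symmetric]
      del: of_int_diff)

definition has_weight :: "'a \<Rightarrow> (('a::field \<times> int) \<times> ('a \<times> int) \<Rightarrow>\<^sub>0 'a) \<Rightarrow> bool"
  where "has_weight w v \<longleftrightarrow>
    (\<forall>a i b j. Poly_Mapping.lookup v ((a, i), (b, j)) \<noteq> 0 \<longrightarrow> a + b = w)"

lemma has_weightD:
  "has_weight w v \<Longrightarrow> a + b \<noteq> w \<Longrightarrow> Poly_Mapping.lookup v ((a, i), (b, j)) = 0"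
  unfolding has_weight_def by blast

text \<open>
  Comparing weights in \<open>[L\<^sub>0, L\<^sub>n] = n L\<^sub>n\<close> shows that a derivation whose value at \<open>L\<^sub>0\<close> has weight 0 is
  homogeneous, and that this value is invariant, hence 0.
\<close>

lemma witt_cocycle_weight_normalise:
  fixes D :: "int \<Rightarrow> (('a::field_char_0 \<times> int) \<times> ('a \<times> int) \<Rightarrow>\<^sub>0 'a)"
  assumes co: "witt_cocycle D"
  obtains r E where "witt_cocycle E" "E 0 = 0" "\<And>n. has_weight (of_int n) (E n)"
    "\<And>n. D n = E n + witt n \<bullet> r"
proof -
  \<comment> \<open>\<open>L\<^sub>0\<close> multiplies the part of weight \<open>a + b\<close> by \<open>a + b\<close>, so dividing by it solves \<open>L\<^sub>0 r = D 0\<close> off weight 0.\<close>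
  define \<psi> :: "('a \<times> int) \<times> ('a \<times> int) \<Rightarrow> 'a"
    where "\<psi> = (\<lambda>((a, i), (b, j)). if a + b = 0 then 0 else 1 / (a + b))"
  define r where "r = lin_ext (\<lambda>p. Poly_Mapping.single p (\<psi> p)) (D 0)"
  have "Poly_Mapping.lookup (lin_ext (\<lambda>p. Poly_Mapping.single p (\<psi> p)) v) p = \<psi> p * Poly_Mapping.lookup v p"
    for v p
    by (induction v rule: single_add_induct)
       (simp_all add: lookup_single when_def lookup_add distrib_left mult.commute)
  then have r: "Poly_Mapping.lookup r p = \<psi> p * Poly_Mapping.lookup (D 0) p" for p
    unfolding r_def .
  define E where "E n = D n - witt n \<bullet> r" for n
  have Eco: "witt_cocycle E"
    unfolding E_def by (rule witt_cocycle_diff_coboundary[OF co])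
  have rel: "of_int n * Poly_Mapping.lookup (E n) ((a, i), (b, j)) =
      (a + b) * Poly_Mapping.lookup (E n) ((a, i), (b, j)) -
      Poly_Mapping.lookup (witt n \<bullet> E 0) ((a, i), (b, j))" for n a i b j
  proof -
    have "of_int (n - 0) *\<^sub>p E (0 + n) = witt 0 \<bullet> E n - witt n \<bullet> E 0"
      using Eco unfolding witt_cocycle_def by blast
    from arg_cong[OF this, of "\<lambda>v. Poly_Mapping.lookup v ((a, i), (b, j))"] show ?thesis
      by (simp add: lookup_minus lookup_witt_act[of 0] distrib_right)
  qed
  have wt0: "has_weight 0 (E 0)"
    unfolding has_weight_def
  proof (intro allI impI, rule ccontr)
    fix a i b j assume "Poly_Mapping.lookup (E 0) ((a, i), (b, j)) \<noteq> 0" "a + b \<noteq> 0"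
    then show False
      by (simp add: E_def lookup_minus lookup_witt_act r \<psi>_def flip: distrib_right add_divide_distrib)
  qed
  have E0act: "Poly_Mapping.lookup (witt n \<bullet> E 0) ((a, i), (b, j)) = 0" if "a + b \<noteq> of_int n" for n a i b j
    using that by (auto simp: lookup_witt_act has_weightD[OF wt0] algebra_simps)
  have wt: "has_weight (of_int n) (E n)" for n
    unfolding has_weight_def
  proof (intro allI impI, rule ccontr)
    fix a i b j assume *: "Poly_Mapping.lookup (E n) ((a, i), (b, j)) \<noteq> 0" "a + b \<noteq> of_int n"
    then show False
      using rel[of n a i b j] E0act[OF *(2), of i j] by simp
  qed
  have "witt n \<bullet> E 0 = 0" for n
  proof (rule poly_mapping_eqI)
    fix k :: "('a \<times> int) \<times> ('a \<times> int)"
    obtain a i b j where k: "k = ((a, i), (b, j))" by (metis prod.exhaust)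
    show "Poly_Mapping.lookup (witt n \<bullet> E 0) k = Poly_Mapping.lookup 0 k"
      using rel[of n a i b j] E0act[of a b n i j] by (cases "a + b = of_int n") (auto simp: k)
  qed
  then have "E 0 = 0" by (rule witt_invariant_eq_0)
  show ?thesis
    by (rule that[OF Eco \<open>E 0 = 0\<close> wt, of r]) (simp add: E_def)
qed

lemma coset_representatives:
  obtains rep :: "'a::field_char_0 \<Rightarrow> 'a" and idx :: "'a \<Rightarrow> int"
  where "\<And>a. a = rep a + of_int (idx a)" "\<And>a n. rep (a + of_int n) = rep a"
    "\<And>a n. idx (a + of_int n) = idx a + n"
proof -
  define rep :: "'a \<Rightarrow> 'a" where "rep a = (SOME c. \<exists>k::int. a = c + of_int k)" for a
  have rep: "\<exists>k::int. a = rep a + of_int k" for a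
    unfolding rep_def by (rule someI[of _ a]) (auto intro: exI[of _ 0])
  have "(\<exists>k::int. a + of_int n = c + of_int k) \<longleftrightarrow> (\<exists>k::int. a = c + of_int k)" for a c :: 'a and n
    by (metis (no_types, opaque_lifting) add_diff_cancel_right' add_diff_eq of_int_add of_int_diff diff_add_cancel)
  then have rep_shift: "rep (a + of_int n) = rep a" for a n
    unfolding rep_def by simp
  obtain idx where idx: "\<And>a. a = rep a + of_int (idx a)" using rep by metis
  have "(of_int (idx (a + of_int n)) :: 'a) = of_int (idx a + n)" for a n
    using idx[of "a + of_int n"] idx[of a] rep_shift[of a n]
    by (metis add.assoc add_left_cancel of_int_add)
  then have "idx (a + of_int n) = idx a + n" for a n by (simp only: of_int_eq_iff)
  with idx rep_shift that show ?thesis by blast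
qed

lemma witt_cocycle_slice:
  fixes E :: "int \<Rightarrow> (('a::field_char_0 \<times> int) \<times> ('a \<times> int) \<Rightarrow>\<^sub>0 'a)"
  assumes co: "witt_cocycle E"
  defines "d \<equiv> \<lambda>i j c n x. Poly_Mapping.lookup (E n) ((c + of_int x, i), (of_int (n - x) - c, j))"
  shows "weight_cocycle c (d i j c)" and "finite {x. d i j c n x \<noteq> 0}"
proof -
  show "weight_cocycle c (d i j c)"
    unfolding weight_cocycle_def
  proof (intro allI)
    fix m n x
    let ?k = "((c + of_int x, i), (of_int (m + n - x) - c, j))"
    have "of_int (n - m) * Poly_Mapping.lookup (E (m + n)) ?k =
        Poly_Mapping.lookup (witt m \<bullet> E n) ?k - Poly_Mapping.lookup (witt n \<bullet> E m) ?k"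
      using co unfolding witt_cocycle_def by (metis lookup_scale_pm lookup_minus)
    then show "of_int (n - m) * d i j c (m + n) x =
        weight_act c m n (d i j c n) x - weight_act c n m (d i j c m) x"
      by (simp add: d_def weight_act_def lookup_witt_act algebra_simps)
  qed
  show "finite {x. d i j c n x \<noteq> 0}"
  proof (rule inj_on_finite)
    show "inj_on (\<lambda>x. ((c + of_int x, i), (of_int (n - x) - c, j))) {x. d i j c n x \<noteq> 0}"
      by (auto simp: inj_on_def)
    show "(\<lambda>x. ((c + of_int x, i), (of_int (n - x) - c, j))) ` {x. d i j c n x \<noteq> 0} \<subseteq> Poly_Mapping.keys (E n)"
      by (auto simp: d_def in_keys_iff)
  qed simp
qed

text \<open>
  The coset pieces are primitives of finite support, one for each pair of exponents of \<open>t\<close> and each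
  integer coset.  Only finitely many of them are needed: the values at the four generators have
  finite support, and a piece on which these four values vanish is 0.
\<close>

lemma witt_cocycle_coboundary_of_weight:
  fixes E :: "int \<Rightarrow> (('a::field_char_0 \<times> int) \<times> ('a \<times> int) \<Rightarrow>\<^sub>0 'a)"
  assumes co: "witt_cocycle E" and zero: "E 0 = 0" and wt: "\<And>n. has_weight (of_int n) (E n)"
  obtains r where "\<And>n. E n = witt n \<bullet> r"
proof -
  define d where "d i j c n x = Poly_Mapping.lookup (E n) ((c + of_int x, i), (of_int (n - x) - c, j))"
    for i j c n x
  have dco: "weight_cocycle c (d i j c)" and dfin: "finite {x. d i j c n x \<noteq> 0}" for i j c n
    using witt_cocycle_slice[OF co, where c = c and i = i and j = j] unfolding d_def by blast+
  obtain rep :: "'a \<Rightarrow> 'a" and idx where rep: "\<And>a. a = rep a + of_int (idx a)"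
    "\<And>a n. rep (a + of_int n) = rep a" "\<And>a n. idx (a + of_int n) = idx a + n"
    by (rule coset_representatives) blast
  define good where "good i j c s \<longleftrightarrow> finite {x. s x \<noteq> 0} \<and> (\<forall>n x. d i j c n x = weight_act c n 0 s x)"
    for i j c s
  have ex: "\<exists>s. good i j c s" for i j c
    using weight_cocycle_coboundary[OF dco[of c i j] _ dfin] unfolding good_def
    by (metis d_def zero lookup_zero)
  \<comment> \<open>The choice of \<open>0\<close> wherever possible leaves only finitely many nonzero \<open>R i j c\<close>.\<close>
  define R where "R i j c = (if good i j c (\<lambda>_. 0) then (\<lambda>_. 0) else (SOME s. good i j c s))" for i j c
  have R: "good i j c (R i j c)" for i j c
    using someI_ex[OF ex[of i j c]] by (simp add: R_def)
  define \<rho> where "\<rho> = (\<lambda>((a, i), (b, j)). if a + b = 0 then R i j (rep a) (idx a) else 0)"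
  define K where "K = (\<Union>n\<in>{1, - 1, 2, - 2}. Poly_Mapping.keys (E n))"
  have R0: "R i j c = (\<lambda>_. 0)" if no: "\<And>a b. ((a, i), (b, j)) \<in> K \<Longrightarrow> rep a \<noteq> c" and c: "rep c = c" for i j c
  proof -
    have "d i j c n x = 0" if "n \<in> {1, - 1, 2, - 2}" for n x
    proof (rule ccontr)
      assume "d i j c n x \<noteq> 0"
      then have "((c + of_int x, i), (of_int (n - x) - c, j)) \<in> K"
        using that by (auto simp: K_def d_def in_keys_iff)
      then have "rep (c + of_int x) \<noteq> c" by (rule no)
      with rep(2) c show False by simp
    qed
    then have "d i j c n x = 0" for n x
      using weight_cocycle_eq_0[OF dco[of c i j]] by blast
    then have "good i j c (\<lambda>_. 0)" by (simp add: good_def weight_act_def)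
    then show ?thesis by (simp add: R_def)
  qed
  have reprep: "rep (rep a) = rep a" for a
    using rep(1)[of a] rep(2)[of "rep a" "idx a"] by simp
  let ?cell = "\<lambda>((a, i), (b, j)). (\<lambda>x. ((rep a + of_int x, i), (- (rep a + of_int x), j))) ` {x. R i j (rep a) x \<noteq> 0}"
  have "finite {p. \<rho> p \<noteq> 0}"
  proof (rule finite_subset)
    show "{p. \<rho> p \<noteq> 0} \<subseteq> (\<Union>p\<in>K. ?cell p)"
    proof
      fix p assume "p \<in> {p. \<rho> p \<noteq> 0}"
      moreover obtain a i b j where p: "p = ((a, i), (b, j))" by (metis prod.exhaust)
      ultimately have ab: "a + b = 0" and nz: "R i j (rep a) (idx a) \<noteq> 0"
        by (auto simp: \<rho>_def split: if_splits)
      then obtain a' b' where a': "((a', i), (b', j)) \<in> K" "rep a' = rep a"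
        using R0[OF _ reprep, of i j a] by metis
      have "p = ((rep a + of_int (idx a), i), (- (rep a + of_int (idx a)), j))"
        using ab rep(1)[of a] by (simp add: p eq_neg_iff_add_eq_0 add.commute)
      with a' nz show "p \<in> (\<Union>p\<in>K. ?cell p)"
        by (intro UN_I[OF a'(1)]) auto
    qed
    have "finite {x. R i j c x \<noteq> 0}" for i j c using R unfolding good_def by blast
    then show "finite (\<Union>p\<in>K. ?cell p)" by (auto simp: K_def)
  qed
  then have look: "Poly_Mapping.lookup (Abs_poly_mapping \<rho>) = \<rho>"
    by (rule lookup_Abs_poly_mapping)
  show ?thesis
  proof (rule that[of "Abs_poly_mapping \<rho>"], rule poly_mapping_eqI)
    fix n and k :: "('a \<times> int) \<times> ('a \<times> int)"
    obtain a i b j where k: "k = ((a, i), (b, j))" by (metis prod.exhaust)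
    show "Poly_Mapping.lookup (E n) k = Poly_Mapping.lookup (witt n \<bullet> Abs_poly_mapping \<rho>) k"
    proof (cases "a + b = of_int n")
      case True
      then have shifted: "a - of_int n + b = 0" "a + (b - of_int n) = 0" by (simp_all add: algebra_simps)
      define c x where "c = rep a" and "x = idx a"
      have a: "a = c + of_int x" and b: "b = of_int (n - x) - c"
        using rep(1)[of a] True by (simp_all add: c_def x_def algebra_simps)
      have "rep (a - of_int n) = c" "idx (a - of_int n) = x - n"
        using rep(2,3)[of a "- n"] by (simp_all add: c_def x_def)
      then have "\<rho> ((a - of_int n, i), (b, j)) = R i j c (x - n)" "\<rho> ((a, i), (b - of_int n, j)) = R i j c x"
        using shifted True by (simp_all add: \<rho>_def c_def x_def)
      then have "Poly_Mapping.lookup (witt n \<bullet> Abs_poly_mapping \<rho>) k =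
          (a - 2 * of_int n) * R i j c (x - n) + (b - 2 * of_int n) * R i j c x"
        by (simp add: k lookup_witt_act look)
      also have "\<dots> = weight_act c n 0 (R i j c) x"
        unfolding weight_act_def a b by (simp add: algebra_simps)
      also have "\<dots> = d i j c n x" using R by (simp add: good_def)
      finally show ?thesis unfolding d_def k a[symmetric] b[symmetric] by (rule sym)
    next
      case False
      then have shifted: "a - of_int n + b \<noteq> 0" "a + (b - of_int n) \<noteq> 0" by (auto simp: algebra_simps)
      show ?thesis
        using has_weightD[OF wt False, of i j] shifted unfolding k lookup_witt_act look
        by (simp add: \<rho>_def)
    qed
  qed
qed

theorem witt_cocycle_coboundary:
  fixes D :: "int \<Rightarrow> (('a::field_char_0 \<times> int) \<times> ('a \<times> int) \<Rightarrow>\<^sub>0 'a)"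
  assumes "witt_cocycle D"
  obtains r where "\<And>n. D n = witt n \<bullet> r"
proof -
  obtain r E where E: "witt_cocycle E" "E 0 = 0" "\<And>n. has_weight (of_int n) (E n)"
    "\<And>n. D n = E n + witt n \<bullet> r"
    by (rule witt_cocycle_weight_normalise[OF assms]) (rule that)
  obtain s where "\<And>n. E n = witt n \<bullet> s"
    by (rule witt_cocycle_coboundary_of_weight[OF E(1-3)]) (rule that)
  then show ?thesis
    using that[of "s + r"] by (simp add: E(4) diag_action_add)
qed

section \<open>Lie bialgebra structures on the generalized loop Virasoro algebra\<close>

lemma of_int_mem_additive_subgroup:
  assumes "additive_subgroup_of_field \<Gamma>" "1 \<in> \<Gamma>"
  shows "of_int n \<in> \<Gamma>"
  using assms unfolding additive_subgroup_of_field_def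
  by (induction n rule: int_induct[of _ 0]) (auto simp: diff_conv_add_uminus simp del: add_uminus_conv_diff)

lemma add_of_int_mem_iff:
  assumes "additive_subgroup_of_field \<Gamma>" "1 \<in> \<Gamma>"
  shows "a + of_int n \<in> \<Gamma> \<longleftrightarrow> a \<in> \<Gamma>"
proof
  assume "a + of_int n \<in> \<Gamma>"
  then have "(a + of_int n) + of_int (- n) \<in> \<Gamma>"
    using assms(1) of_int_mem_additive_subgroup[OF assms] unfolding additive_subgroup_of_field_def by blast
  then show "a \<in> \<Gamma>" by simp
qed (use assms(1) of_int_mem_additive_subgroup[OF assms] in \<open>auto simp: additive_subgroup_of_field_def\<close>)

text \<open>
  The tensor obtained from the Witt algebra is a priori supported on the whole field.  Translation by
  integers preserves \<open>\<Gamma>\<close> and its complement, so the part of the tensor outside \<open>\<Gamma>\<close> is killed by all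
  \<open>L\<^sub>n\<close> and hence is zero.
\<close>

lemma witt_primitive_in_free_space:
  fixes r :: "('a::field_char_0 \<times> int) \<times> ('a \<times> int) \<Rightarrow>\<^sub>0 'a"
  assumes \<Gamma>: "additive_subgroup_of_field \<Gamma>" "1 \<in> \<Gamma>"
    and mem: "\<And>n. witt n \<bullet> r \<in> free_space (loop_virasoro_basis \<Gamma> \<times> loop_virasoro_basis \<Gamma>)"
  shows "r \<in> free_space (loop_virasoro_basis \<Gamma> \<times> loop_virasoro_basis \<Gamma>)"
proof -
  have "Poly_Mapping.lookup r p = 0" if out: "p \<notin> loop_virasoro_basis \<Gamma> \<times> loop_virasoro_basis \<Gamma>" for p
  proof -
    obtain a i b j where p: "p = ((a, i), (b, j))" by (metis prod.exhaust)
    show ?thesis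
      unfolding p
    proof (rule lookup_eq_0_of_witt_act)
      fix n
      have "((a + of_int n, i), (b, j)) \<notin> loop_virasoro_basis \<Gamma> \<times> loop_virasoro_basis \<Gamma>"
        using out add_of_int_mem_iff[OF \<Gamma>] by (auto simp: p loop_virasoro_basis_def)
      then show "Poly_Mapping.lookup (witt n \<bullet> r) ((a + of_int n, i), (b, j)) = 0"
        using mem[of n] by (auto simp: free_space_def in_keys_iff)
    qed
  qed
  then show ?thesis unfolding free_space_def by (metis (mono_tags) in_keys_iff mem_Collect_eq subsetI)
qed

text \<open>
  The inner derivation that agrees with \<open>\<Delta>\<close> on the Witt algebra agrees with it everywhere, because the
  difference intertwines the actions of the Witt algebra on \<open>L\<close> and on \<open>L \<otimes> L\<close>.
\<close>

lemma loop_virasoro_derivation_inner: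
  fixes \<Gamma> :: "'a::field_char_0 set"
    and \<Delta> :: "('a \<times> int \<Rightarrow>\<^sub>0 'a) \<Rightarrow> (('a \<times> int) \<times> ('a \<times> int) \<Rightarrow>\<^sub>0 'a)"
  defines "B \<equiv> loop_virasoro_basis \<Gamma>"
  assumes \<Gamma>: "additive_subgroup_of_field \<Gamma>" "1 \<in> \<Gamma>"
    and lin: "linear_on (free_space B) (free_space (B \<times> B)) \<Delta>"
    and der: "\<And>x y. x \<in> free_space B \<Longrightarrow> y \<in> free_space B \<Longrightarrow>
      \<Delta> (loop_virasoro_bracket x y) = x \<bullet> \<Delta> y - y \<bullet> \<Delta> x"
  obtains r where "r \<in> free_space (B \<times> B)" "\<And>x. x \<in> free_space B \<Longrightarrow> \<Delta> x = x \<bullet> r"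
proof -
  let ?br = "loop_virasoro_bracket :: ('a \<times> int, 'a) bracket"
  let ?e = "\<lambda>b. Poly_Mapping.single b (1::'a)"
  have witt_mem: "witt n \<in> free_space B" for n
    using of_int_mem_additive_subgroup[OF \<Gamma>]
    by (simp add: witt_def free_space_def B_def loop_virasoro_basis_def)
  have witt_br: "?br (witt n) (?e (\<beta>, i)) = (\<beta> - of_int n) *\<^sub>p ?e (\<beta> + of_int n, i)" for n \<beta> i
    by (simp add: witt_def loop_virasoro_bracket_basis add.commute del: scale_single)
  have scale: "\<Delta> (c *\<^sub>p x) = c *\<^sub>p \<Delta> x" and add: "\<Delta> (x + y) = \<Delta> x + \<Delta> y"
    if "x \<in> free_space B" "y \<in> free_space B" for c x y
    using lin that by (simp_all add: linear_on_def)
  have "witt_cocycle (\<lambda>n. \<Delta> (witt n))"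
    unfolding witt_cocycle_def
  proof (intro allI)
    fix m n
    have "?br (witt m) (witt n) = of_int (n - m) *\<^sub>p witt (m + n)"
      using witt_br[of m "of_int n" 0] by (simp add: witt_def add.commute del: scale_single)
    then show "of_int (n - m) *\<^sub>p \<Delta> (witt (m + n)) = witt m \<bullet> \<Delta> (witt n) - witt n \<bullet> \<Delta> (witt m)"
      using der[OF witt_mem witt_mem, of m n] scale[OF witt_mem witt_mem] by simp
  qed
  then obtain r where r: "\<And>n. \<Delta> (witt n) = witt n \<bullet> r"
    by (rule witt_cocycle_coboundary) (rule that)
  have "witt n \<bullet> r \<in> free_space (B \<times> B)" for n
    using lin witt_mem[of n] unfolding r[symmetric] linear_on_def by blast
  then have r_mem: "r \<in> free_space (B \<times> B)"
    unfolding B_def by (rule witt_primitive_in_free_space[OF \<Gamma>])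
  define E where "E x = \<Delta> x - x \<bullet> r" for x
  have act_linear: "(x + y) \<bullet> r = x \<bullet> r + y \<bullet> r" "(c *\<^sub>p x) \<bullet> r = c *\<^sub>p (x \<bullet> r)" for c x y
    by (simp_all add: loop.diag_action_left)
  have E_scale: "E (c *\<^sub>p x) = c *\<^sub>p E x" and E_add: "E (x + y) = E x + E y"
    if "x \<in> free_space B" "y \<in> free_space B" for c x y
    using scale[OF that] add[OF that] by (simp_all add: E_def act_linear pm.scale_right_diff_distrib)
  have E_br: "E (?br (witt n) x) = witt n \<bullet> E x" if "x \<in> free_space B" for n x
    using der[OF witt_mem that, of n] by (simp add: E_def r loop.diag_action_bracket diag_action_diff)
  have E_basis: "E (?e b) = 0" if b: "b \<in> B" for b
  proof -
    obtain \<beta> i where \<beta>: "b = (\<beta>, i)" by force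
    have mem: "?e (\<beta> + of_int n, i) \<in> free_space B" for n
      using b add_of_int_mem_iff[OF \<Gamma>] by (simp add: \<beta> free_space_def B_def loop_virasoro_basis_def)
    have step: "witt n \<bullet> E (?e (\<beta> + of_int m, i)) =
        (\<beta> + of_int m - of_int n) *\<^sub>p E (?e (\<beta> + of_int (m + n), i))" for m n
    proof -
      have shift: "\<beta> + of_int m + of_int n = \<beta> + of_int (m + n)" by simp
      show ?thesis
        unfolding E_br[OF mem, symmetric] witt_br shift by (rule E_scale[OF mem mem])
    qed
    have "witt (- n) \<bullet> witt n \<bullet> E (?e b) = ((\<beta> - of_int n) * (\<beta> + 2 * of_int n)) *\<^sub>p E (?e b)" for n
    proof -
      have "witt n \<bullet> E (?e (\<beta> + of_int 0, i)) =
          (\<beta> + of_int 0 - of_int n) *\<^sub>p E (?e (\<beta> + of_int (0 + n), i))"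
        by (rule step)
      then have one: "witt n \<bullet> E (?e b) = (\<beta> - of_int n) *\<^sub>p E (?e (\<beta> + of_int n, i))"
        unfolding \<beta> of_int_0 add_0_right add_0_left .
      have two: "witt (- n) \<bullet> E (?e (\<beta> + of_int n, i)) =
          (\<beta> + of_int n - of_int (- n)) *\<^sub>p E (?e (\<beta> + of_int (n + - n), i))"
        by (rule step)
      have coeffs: "\<beta> + of_int n - of_int (- n) = \<beta> + 2 * of_int n" "\<beta> + of_int (n + - n) = \<beta>"
        by simp_all
      show ?thesis
        unfolding one diag_action_scale two coeffs \<beta>[symmetric] pm.scale_scale ..
    qed
    then show ?thesis by (rule witt_intertwiner_eq_0)
  qed
  have "E x = 0" if "x \<in> free_space B" for x
  proof -
    have "x \<in> free_space B \<and> E x = 0"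
      using that
    proof (induction x rule: free_space_induct)
      case (basis b)
      then show ?case using E_basis by (simp add: free_space_def)
    next
      case zero
      then show ?case using E_scale[OF witt_mem witt_mem, of 0] by (simp add: free_space_def)
    next
      case (add f g)
      then show ?case using E_add[of f g] keys_add[of f g] by (auto simp: free_space_def)
    next
      case (scale c f)
      then have "Poly_Mapping.keys (c *\<^sub>p f) \<subseteq> B" by (auto simp: free_space_def in_keys_iff)
      with scale show ?case using E_scale[of f f c] by (auto simp: free_space_def)
    qed
    then show ?thesis ..
  qed
  then show ?thesis using that[OF r_mem] by (simp add: E_def)
qed

theorem theorem3p7:
  fixes \<Gamma> :: "'a::field_char_0 set"
    and \<Delta> :: "('a \<times> int \<Rightarrow>\<^sub>0 'a) \<Rightarrow> (('a \<times> int) \<times> ('a \<times> int) \<Rightarrow>\<^sub>0 'a)"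
  assumes "additive_subgroup_of_field \<Gamma>" and "1 \<in> \<Gamma>"
    and "lie_bialgebra (loop_virasoro_basis \<Gamma>) loop_virasoro_bracket \<Delta>"
  shows "\<exists>r \<in> skew_tensors (loop_virasoro_basis \<Gamma>).
    (\<forall>x \<in> free_space (loop_virasoro_basis \<Gamma>). \<Delta> x = diag_action loop_virasoro_bracket x r) \<and>
    classical_yang_baxter (loop_virasoro_basis \<Gamma>) loop_virasoro_bracket r"
proof -
  let ?B = "loop_virasoro_basis \<Gamma>"
  have co: "lie_coalgebra ?B \<Delta>"
    and der: "\<And>x y. x \<in> free_space ?B \<Longrightarrow> y \<in> free_space ?B \<Longrightarrow>
      \<Delta> (loop_virasoro_bracket x y) = x \<bullet> \<Delta> y - y \<bullet> \<Delta> x"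
    using assms(3) by (simp_all add: lie_bialgebra_def)
  have lin: "linear_on (free_space ?B) (free_space (?B \<times> ?B)) \<Delta>"
    and skew: "\<Delta> ` free_space ?B \<subseteq> skew_tensors ?B"
    using co by (simp_all add: lie_coalgebra_def)
  obtain r where r: "r \<in> free_space (?B \<times> ?B)" and inner: "\<And>x. x \<in> free_space ?B \<Longrightarrow> \<Delta> x = x \<bullet> r"
    by (rule loop_virasoro_derivation_inner[OF assms(1,2) lin der]) (auto intro: that)
  have witt_mem: "witt n \<in> free_space ?B" for n
    using of_int_mem_additive_subgroup[OF assms(1,2)]
    by (simp add: witt_def free_space_def loop_virasoro_basis_def)
  have "witt n \<bullet> (r + twist r) = 0" for n
  proof -
    obtain v where "witt n \<bullet> r = v - twist v"
      using skew witt_mem[of n] unfolding inner[OF witt_mem, symmetric] skew_tensors_def by blast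
    then have "twist (witt n \<bullet> r) = - (witt n \<bullet> r)" by (simp add: twist_diff)
    then show ?thesis by (simp add: diag_action_add loop.twist_diag_action[symmetric])
  qed
  then have "r + twist r = 0" by (rule witt_invariant_eq_0)
  then have twist_r: "twist r = - r" by (simp add: add_eq_0_iff)
  have "r = (1 / 2) *\<^sub>p r - twist ((1 / 2) *\<^sub>p r)"
    by (simp add: twist_r flip: pm.scale_left_distrib)
  moreover have "(1 / 2) *\<^sub>p r \<in> free_space (?B \<times> ?B)"
    using r by (auto simp: free_space_def in_keys_iff)
  ultimately have "r \<in> skew_tensors ?B"
    unfolding skew_tensors_def by (rule image_eqI)
  moreover have "yb loop_virasoro_bracket r r = 0"
    by (rule witt_invariant3_eq_0) (rule loop.act3_yb_eq_0[OF co twist_r inner witt_mem])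
  then have "classical_yang_baxter ?B loop_virasoro_bracket r"
    by (rule classical_yang_baxterI[OF loop.total_lie_algebra_axioms r])
  ultimately show ?thesis using inner by blast
qed

end
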